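(* There exist universal constants $c_1 \in \mathbb{R}^+$, $c_2 \in (0,1/2)$, $c_3 \in \mathbb{Z}^+$, $c_4 \in \mathbb{R}^+$, $c_5 \in (0,1)$ such that the following holds. Let $G$ be generated from $\mathrm{VBM}(n,\varepsilon_1,\varepsilon_2,p_1,p_2,c,r,\lambda_1,\lambda_2)$ with $p_1,p_2 \in (c_1(\log n)/n,\,1]$, $\varepsilon_1,\varepsilon_2 \in [1/n, c_2]$, $c \le c_3$, $r \le c_4$ and $\lambda_1,\lambda_2 \ge c_5$, and let $S$ be the planted set in the model. Then, with probability at least $1-1/\mathrm{poly}(n)$, the pair $(U',\eta')$ given by $U' = \mathbb{1}_S\mathbb{1}_S^T$ and $\eta'_i = \max_{j\in N(i)}(\mathbb{1}_S(i)-\mathbb{1}_S(j))^2$ for each $i \in V$ is the unique optimal solution of the semidefinite program $$\min \sum_{i\in V}\eta_i \quad\text{subject to}\quad U_{ii}+U_{jj}-2U_{ij}\le \eta_i\ \ (\forall i\in V,\ j\in N(i)),\quad U_{ii}=1\ \ (\forall i\in V),\quad \sum_{i\in V}\sum_{j\in V}U_{ij}=0,\quad U\succeq 0 .$$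
   Context: $N(i)$ is the set of neighbours of $i$ in $G=(V,E)$. For $S\subseteq V$, $\mathbb{1}_S\in\{-1,1\}^V$ is the vector with $\mathbb{1}_S(i)=1$ if $i\in S$ and $-1$ otherwise. In the SDP the variables are a symmetric matrix $U\in\mathbb{R}^{V\times V}$ and reals $\eta_i$, $i\in V$. The spectral gap of a graph is the second smallest eigenvalue of its normalized Laplacian $I - D^{-1/2}AD^{-1/2}$. The model $\mathrm{VBM}(n,\varepsilon_1,\varepsilon_2,p_1,p_2,c,r,\lambda_1,\lambda_2)$ generates a graph $G$ as follows. (1) Let $V$ be a set of $n$ vertices. Partition $V$ (arbitrarily) into two sets $S$ and $S'$ of $n/2$ vertices each. Partition $S$ into $T$ and $S\setminus T$ of sizes $\varepsilon_1 n$ and $(1/2-\varepsilon_1)n$ respectively; partition $S'$ into $T'$ and $S'\setminus T'$ of sizes $\varepsilon_2 n$ and $(1/2-\varepsilon_2)n$ respectively. (2) Between each pair in $(S\setminus T)\times T$ (resp. $(S'\setminus T')\times T'$) add an edge independently with probability $p_1$ (resp. $p_2$). (3) Between pairs of vertices in $S\setminus T$ (resp. $S'\setminus T'$) add edges to form an arbitrary roughly regular graph (the ratio of maximum to minimum vertex degree is at most $r$) of spectral gap at least $\lambda_1$ (resp. $\lambda_2$). (4) Between pairs in $T\times T'$ add edges to form an arbitrary bipartite graph, denoted $\mathcal{F}$, with vertex degrees in the range $[1,c]$ (it need not be connected); if $c<1$, add no edges in this step. (5) (Monotone adversary) Arbitrarily add edges between any pair of vertices in $S$, between any pair of vertices in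 $S'$, and between any pair in $T\times T'$. The graph $G$ is output. The only randomness is in step (2); all choices described as arbitrary are adversarial (worst-case). $1/\mathrm{poly}(n)$ denotes an inverse polynomial in $n$.
   Formalization: In the degenerate case c<1 (no edges added in step 4), the monotone adversary of step 5 may not add edges in T×T' either; otherwise joining one vertex of T to all of a large T' makes the planted solution non-optimal. Also c_4≥1 is required, which excludes an empty model. *)

theory Defs
  imports
    "HOL-Probability.Probability"
    "Jordan_Normal_Form.Char_Poly"
begin

unbundle no vec_syntax
unbundle no inner_syntax

text \<open>
  Graphs are simple, with vertices in \<open>nat\<close>, and are given by their edge set, a set of two-element
  sets of vertices. The graph on n vertices has vertex set \<open>{..<n}\<close>, so that matrices indexed
  by its vertices are n-by-n matrices.
\<close>

type_synonym edges = "nat set set"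

definition pairs :: "nat set \<Rightarrow> edges" where
  "pairs A = {{i, j} | i j. i \<in> A \<and> j \<in> A \<and> i \<noteq> j}"

definition cross :: "nat set \<Rightarrow> nat set \<Rightarrow> edges" where
  "cross A B = {{i, j} | i j. i \<in> A \<and> j \<in> B}"

definition nbrs :: "edges \<Rightarrow> nat \<Rightarrow> nat set" where
  "nbrs E i = {j. {i, j} \<in> E}"

definition vdegree :: "edges \<Rightarrow> nat \<Rightarrow> nat" where
  "vdegree E i = card (nbrs E i)"

text \<open>
  For a graph with finite vertex set W, matrix indices enumerate W increasingly.
\<close>

definition adjacency_mat :: "nat set \<Rightarrow> edges \<Rightarrow> real mat" where
  "adjacency_mat W E =
     (let vs = sorted_list_of_set W
      in mat (card W) (card W) (\<lambda>(a, b). if {vs ! a, vs ! b} \<in> E then 1 else 0))"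

definition inv_sqrt_degree_mat :: "nat set \<Rightarrow> edges \<Rightarrow> real mat" where
  "inv_sqrt_degree_mat W E =
     (let vs = sorted_list_of_set W
      in mat_diag (card W) (\<lambda>a. 1 / sqrt (real (vdegree E (vs ! a)))))"

definition normalized_laplacian :: "nat set \<Rightarrow> edges \<Rightarrow> real mat" where
  "normalized_laplacian W E =
     1\<^sub>m (card W) - inv_sqrt_degree_mat W E * adjacency_mat W E * inv_sqrt_degree_mat W E"

text \<open>
  Eigenvalues are counted with multiplicity. The normalized Laplacian is real symmetric, so all
  roots of its characteristic polynomial are real and the list below has \<open>card W\<close> entries.
  The definition is only used for graphs of positive minimum degree
  (hence with at least two vertices).
\<close>

definition spectral_gap :: "nat set \<Rightarrow> edges \<Rightarrow> real" where
  "spectral_gap W E =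
     sorted_list_of_multiset (proots (char_poly (normalized_laplacian W E))) ! 1"

text \<open>
  The minimum degree is required to be positive because otherwise neither the ratio of degrees nor
  the normalized Laplacian is defined (division by zero is zero in HOL).
\<close>

definition roughly_regular :: "nat set \<Rightarrow> edges \<Rightarrow> real \<Rightarrow> bool" where
  "roughly_regular W E r \<longleftrightarrow>
     0 < Min (vdegree E ` W) \<and>
     real (Max (vdegree E ` W)) / real (Min (vdegree E ` W)) \<le> r"

definition planted_partition ::
  "nat \<Rightarrow> real \<Rightarrow> real \<Rightarrow> nat set \<Rightarrow> nat set \<Rightarrow> nat set \<Rightarrow> nat set \<Rightarrow> bool" where
  "planted_partition n \<epsilon>1 \<epsilon>2 S T S' T' \<longleftrightarrow>
     S \<union> S' = {..<n} \<and> S \<inter> S' = {} \<and>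
     real (card S) = real n / 2 \<and> real (card S') = real n / 2 \<and>
     T \<subseteq> S \<and> real (card T) = \<epsilon>1 * real n \<and>
     T' \<subseteq> S' \<and> real (card T') = \<epsilon>2 * real n"

definition random_edges ::
  "real \<Rightarrow> real \<Rightarrow> nat set \<Rightarrow> nat set \<Rightarrow> nat set \<Rightarrow> nat set \<Rightarrow> edges pmf" where
  "random_edges p1 p2 S T S' T' =
     map_pmf (\<lambda>\<omega>. {e. \<omega> e})
       (Pi_pmf (cross (S - T) T \<union> cross (S' - T') T') False
          (\<lambda>e. bernoulli_pmf (if e \<in> cross (S - T) T then p1 else p2)))"

definition cut_edges :: "real \<Rightarrow> nat set \<Rightarrow> nat set \<Rightarrow> edges \<Rightarrow> bool" where
  "cut_edges c T T' F \<longleftrightarrow>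
     (if c < 1 then F = {}
      else F \<subseteq> cross T T' \<and>
           (\<forall>i \<in> T \<union> T'. 1 \<le> real (vdegree F i) \<and> real (vdegree F i) \<le> c))"

text \<open>
  The pairs that the monotone adversary may add. An edge between T and T' may be added only where
  it leaves the boundary of the planted cut unchanged. For \<open>c \<ge> 1\<close> the boundary is
  \<open>T \<union> T'\<close>, which is covered by the bipartite graph, so all these edges are allowed; for
  \<open>c < 1\<close> the boundary is empty and none is. (If they were allowed for \<open>c < 1\<close>, the
  planted cut need not be optimal: take T a singleton, of which all vertices of a large T' are made
  neighbours, and exchange it with a vertex of T'.)
\<close>

definition monotone_pairs :: "real \<Rightarrow> nat set \<Rightarrow> nat set \<Rightarrow> nat set \<Rightarrow> nat set \<Rightarrow> edges" where
  "monotone_pairs c S T S' T' =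
     pairs S \<union> pairs S' \<union> (if c < 1 then {} else cross T T')"

text \<open>
  The graphs G that the adversary can produce from an outcome R of the random edges.
\<close>

definition completion ::
  "real \<Rightarrow> real \<Rightarrow> real \<Rightarrow> real \<Rightarrow> nat set \<Rightarrow> nat set \<Rightarrow> nat set \<Rightarrow> nat set \<Rightarrow> edges \<Rightarrow> edges \<Rightarrow> bool" where
  "completion c r l1 l2 S T S' T' R G \<longleftrightarrow>
     (\<exists>H H' F M.
        H \<subseteq> pairs (S - T) \<and> roughly_regular (S - T) H r \<and> l1 \<le> spectral_gap (S - T) H \<and>
        H' \<subseteq> pairs (S' - T') \<and> roughly_regular (S' - T') H' r \<and> l2 \<le> spectral_gap (S' - T') H' \<and>
        cut_edges c T T' F \<and>
        M \<subseteq> monotone_pairs c S T S' T' \<and>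
        G = R \<union> H \<union> H' \<union> F \<union> M)"

text \<open>
  The possible distributions of the output graph. The adversary fixes the partition, sees the
  random edges R and then completes them by a strategy \<open>adv\<close>, so all the later choices may
  depend on R.
\<close>

definition VBM ::
  "nat \<Rightarrow> real \<Rightarrow> real \<Rightarrow> real \<Rightarrow> real \<Rightarrow> real \<Rightarrow> real \<Rightarrow> real \<Rightarrow> real \<Rightarrow> nat set \<Rightarrow> edges pmf \<Rightarrow> bool" where
  "VBM n \<epsilon>1 \<epsilon>2 p1 p2 c r l1 l2 S D \<longleftrightarrow>
     (\<exists>T S' T' adv.
        planted_partition n \<epsilon>1 \<epsilon>2 S T S' T' \<and>
        (\<forall>R \<in> set_pmf (random_edges p1 p2 S T S' T').
           completion c r l1 l2 S T S' T' R (adv R)) \<and>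
        D = map_pmf adv (random_edges p1 p2 S T S' T'))"

definition psd :: "nat \<Rightarrow> real mat \<Rightarrow> bool" where
  "psd n U \<longleftrightarrow> (\<forall>x \<in> carrier_vec n. 0 \<le> x \<bullet> (U *\<^sub>v x))"

definition sdp_feasible :: "nat \<Rightarrow> edges \<Rightarrow> real mat \<Rightarrow> real Matrix.vec \<Rightarrow> bool" where
  "sdp_feasible n G U \<eta> \<longleftrightarrow>
     U \<in> carrier_mat n n \<and> \<eta> \<in> carrier_vec n \<and> transpose_mat U = U \<and>
     (\<forall>i<n. \<forall>j \<in> nbrs G i. U $$ (i, i) + U $$ (j, j) - 2 * U $$ (i, j) \<le> \<eta> $ i) \<and>
     (\<forall>i<n. U $$ (i, i) = 1) \<and>
     (\<Sum>i<n. \<Sum>j<n. U $$ (i, j)) = 0 \<and>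
     psd n U"

definition sdp_optimal :: "nat \<Rightarrow> edges \<Rightarrow> real mat \<Rightarrow> real Matrix.vec \<Rightarrow> bool" where
  "sdp_optimal n G U \<eta> \<longleftrightarrow>
     sdp_feasible n G U \<eta> \<and>
     (\<forall>W \<theta>. sdp_feasible n G W \<theta> \<longrightarrow> (\<Sum>i<n. \<eta> $ i) \<le> (\<Sum>i<n. \<theta> $ i))"

definition sign_vec :: "nat set \<Rightarrow> nat \<Rightarrow> real" where
  "sign_vec S i = (if i \<in> S then 1 else -1)"

definition planted_U :: "nat \<Rightarrow> nat set \<Rightarrow> real mat" where
  "planted_U n S = mat n n (\<lambda>(i, j). sign_vec S i * sign_vec S j)"

text \<open>
  The maximum is unspecified at an isolated vertex i; in that case the program is unbounded below
  and has no optimal solution at all.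
\<close>

definition planted_eta :: "nat \<Rightarrow> edges \<Rightarrow> nat set \<Rightarrow> real Matrix.vec" where
  "planted_eta n G S =
     Matrix.vec n (\<lambda>i. Max ((\<lambda>j. (sign_vec S i - sign_vec S j)\<^sup>2) ` nbrs G i))"

end

theory Submission
  imports Defs
begin

text \<open>
  The constants are chosen such that the two expanders are regular and the bipartite graph \<open>F\<close> is a
  perfect matching of the boundary \<open>B = T \<union> T'\<close> (or \<open>F\<close> and \<open>B\<close> are empty, if \<open>c < 1\<close>). Write a
  feasible \<open>U\<close> as a sum of matrices \<open>x x\<^sup>T\<close>, where each \<open>x\<close> sums to 0. Bound \<open>\<eta>\<close> from below at
  a boundary vertex by its matching edge, and at an expander vertex by the mean over its expander
  edges and a small multiple of the sum over its random edges, each with factor 1/2. This leaves a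
  quadratic inequality in \<open>x\<close>. On the boundary, the matching edges fall short of
  \<open>4 (\<Sum>t\<in>B. (x t)\<^sup>2)\<close> by the sum of \<open>(x t + x (f t))\<^sup>2\<close>, where \<open>f t\<close> is the partner of \<open>t\<close>.
  This is bounded by a constant times the squared deviations of \<open>x\<close> on \<open>T\<close> and \<open>T'\<close> from its means over
  the two expanders. The random edges transport these deviations to the expanders: with high
  probability each vertex of \<open>T\<close> has many more neighbours than each vertex of \<open>S - T\<close> has in
  \<open>T\<close>, so they gain a larger constant at the price of a fraction of the squared deviations on the
  expanders, and that is paid for by the spectral gap. Equality forces \<open>x\<close> to be a multiple of the
  planted sign vector.
\<close>

section \<open>Quadratic forms\<close>

text \<open>Symmetric elimination of the last index, as in a Cholesky factorisation: a zero pivot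
  \<open>U n n\<close> forces the whole last column to vanish, a positive one leaves a positive
  semidefinite Schur complement on the first \<open>n\<close> indices.\<close>

lemma psd_gram:
  fixes U :: "nat \<Rightarrow> nat \<Rightarrow> real"
  assumes "\<And>i j. i < n \<Longrightarrow> j < n \<Longrightarrow> U i j = U j i"
    and "\<And>x. 0 \<le> (\<Sum>i<n. \<Sum>j<n. x i * x j * U i j)"
  shows "\<exists>X. \<forall>i<n. \<forall>j<n. U i j = (\<Sum>k<n. X k i * X k j)"
  using assms
proof (induction n arbitrary: U)
  case 0
  then show ?case by simp
next
  case (Suc n)
  note sym = Suc.prems(1)
  have split: "(\<Sum>i<Suc n. \<Sum>j<Suc n. x i * x j * U i j) =
      (\<Sum>i<n. \<Sum>j<n. x i * x j * U i j) + 2 * x n * (\<Sum>i<n. x i * U i n) + (x n)\<^sup>2 * U n n" for x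
  proof -
    have "(\<Sum>j<n. x n * x j * U n j) = x n * (\<Sum>j<n. x j * U j n)"
      unfolding sum_distrib_left by (intro sum.cong) (use sym in auto)
    moreover have "(\<Sum>i<n. x i * x n * U i n) = x n * (\<Sum>i<n. x i * U i n)"
      unfolding sum_distrib_left by (intro sum.cong) auto
    ultimately show ?thesis
      by (simp add: sum.distrib power2_eq_square algebra_simps)
  qed
  have nonneg: "0 \<le> (\<Sum>i<n. \<Sum>j<n. x i * x j * U i j) + 2 * t * (\<Sum>i<n. x i * U i n) + t\<^sup>2 * U n n"
    for x t
    using Suc.prems(2)[of "x(n := t)"] unfolding split by simp
  define u where "u = U n n"
  have "u \<ge> 0"
    using nonneg[of "\<lambda>_. 0" 1] by (simp add: u_def)
  show ?case
  proof (cases "u = 0")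
    case True
    have zero: "U i n = 0" if "i < n" for i
    proof -
      define q where "q = U i i"
      have "0 \<le> q + 2 * t * U i n" for t
        using nonneg[of "\<lambda>j. if j = i then 1 else 0" t] that True
        by (simp add: u_def q_def if_distrib[of "\<lambda>x. x * _"] if_distrib[of "(*) _"] sum.delta cong: if_cong)
      \<comment> \<open>At this \<open>t\<close> the affine function
        \<open>q + 2 * t * U i n\<close> would equal -1, so its slope must be 0.\<close>
      note ineq = this[of "- (q + 1) / (2 * U i n)"]
      show ?thesis
      proof (rule ccontr)
        assume "U i n \<noteq> 0"
        then have "2 * (- (q + 1) / (2 * U i n)) * U i n = - (q + 1)" by simp
        with ineq show False by linarith
      qed
    qed
    have "\<exists>X. \<forall>i<n. \<forall>j<n. U i j = (\<Sum>k<n. X k i * X k j)"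
      by (rule Suc.IH) (use sym nonneg[of _ 0] in auto)
    then obtain X where X: "\<And>i j. i < n \<Longrightarrow> j < n \<Longrightarrow> U i j = (\<Sum>k<n. X k i * X k j)"
      by blast
    define Y where "Y k i = (if k = n \<or> i = n then 0 else X k i)" for k i :: nat
    have "U i j = (\<Sum>k<Suc n. Y k i * Y k j)" if "i < Suc n" "j < Suc n" for i j
      using that True zero X sym[of n j] by (auto simp: Y_def u_def less_Suc_eq)
    then show ?thesis by blast
  next
    case False
    with \<open>u \<ge> 0\<close> have u: "u > 0" by simp
    \<comment> \<open>The Schur complement of the pivot. Its form at \<open>x\<close> is the minimum
      of the full form over the last coordinate, attained at \<open>t = - b / u\<close> with
      \<open>b\<close> as below; hence it is nonnegative.\<close>
    define V where "V i j = U i j - U i n * U j n / u" for i j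
    have "\<exists>X. \<forall>i<n. \<forall>j<n. V i j = (\<Sum>k<n. X k i * X k j)"
    proof (rule Suc.IH)
      show "V i j = V j i" if "i < n" "j < n" for i j
        using that sym by (simp add: V_def)
      show "0 \<le> (\<Sum>i<n. \<Sum>j<n. x i * x j * V i j)" for x
      proof -
        define b where "b = (\<Sum>i<n. x i * U i n)"
        have "(\<Sum>i<n. \<Sum>j<n. x i * x j * V i j) = (\<Sum>i<n. \<Sum>j<n. x i * x j * U i j) -
            (\<Sum>i<n. \<Sum>j<n. (x i * U i n) * (x j * U j n)) / u"
          by (simp add: V_def algebra_simps sum_subtractf sum_divide_distrib)
        also have "(\<Sum>i<n. \<Sum>j<n. (x i * U i n) * (x j * U j n)) = b * b"
          by (simp add: b_def sum_product)
        finally have "(\<Sum>i<n. \<Sum>j<n. x i * x j * V i j) = (\<Sum>i<n. \<Sum>j<n. x i * x j * U i j) - b * b / u" .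
        moreover have "0 \<le> (\<Sum>i<n. \<Sum>j<n. x i * x j * U i j) + 2 * (- b / u) * b + (- b / u)\<^sup>2 * u"
          using nonneg[of x "- b / u"] unfolding b_def u_def .
        moreover have "2 * (- b / u) * b + (- b / u)\<^sup>2 * u = - (b * b / u)"
          using u by (simp add: power2_eq_square field_simps)
        ultimately show ?thesis by simp
      qed
    qed
    then obtain X where X: "\<And>i j. i < n \<Longrightarrow> j < n \<Longrightarrow> V i j = (\<Sum>k<n. X k i * X k j)"
      by blast
    \<comment> \<open>The new row restores the rank-one part \<open>U i n * U j n / u\<close> that
      was subtracted in \<open>V\<close>.\<close>
    define Y where "Y k i = (if k = n then U i n / sqrt u else if i = n then 0 else X k i)" for k i :: nat
    have "U i j = (\<Sum>k<Suc n. Y k i * Y k j)" if "i < Suc n" "j < Suc n" for i j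
    proof (cases "i = n \<or> j = n")
      case True
      then have "(\<Sum>k<n. Y k i * Y k j) = 0"
        by (intro sum.neutral) (auto simp: Y_def)
      then show ?thesis
        using True that u sym[of n j] by (auto simp: Y_def u_def)
    next
      case False
      with that have ij: "i < n" "j < n" by auto
      have "(\<Sum>k<n. Y k i * Y k j) = V i j"
        unfolding X[OF ij] by (intro sum.cong) (use ij in \<open>auto simp: Y_def\<close>)
      then show ?thesis
        using u by (simp add: Y_def V_def)
    qed
    then show ?thesis by blast
  qed
qed

text \<open>In the application \<open>E\<close> is the energy of \<open>x\<close> on the expander and \<open>a\<close> the mean of \<open>x\<close>
  on \<open>W\<close>.\<close>

lemma side_lower_bound:
  fixes x :: "nat \<Rightarrow> real"
  assumes fin: "finite W" "finite T" and \<beta>: "0 \<le> \<beta>"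
    and poincare: "9 / 5 * (\<Sum>w\<in>W. (x w - a)\<^sup>2) \<le> E"
    and deg_T: "\<And>t. t \<in> T \<Longrightarrow> 40 \<le> \<beta> * real (card {w \<in> W. {w, t} \<in> R})"
    and deg_W: "\<And>w. w \<in> W \<Longrightarrow> \<beta> * real (card {t \<in> T. {w, t} \<in> R}) \<le> 1"
  shows "2 / 5 * (\<Sum>w\<in>W. (x w - a)\<^sup>2) + 10 * (\<Sum>t\<in>T. (x t - a)\<^sup>2)
    \<le> E / 2 + (\<Sum>w\<in>W. \<beta> * (\<Sum>t | t \<in> T \<and> {w, t} \<in> R. (x w - x t)\<^sup>2)) / 2"
proof -
  define v where "v i = (x i - a)\<^sup>2" for i
  let ?c = "\<lambda>w t. if {w, t} \<in> R then 1 else 0 :: real"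
  have cW: "(\<Sum>t | t \<in> T \<and> {w, t} \<in> R. f t) = (\<Sum>t\<in>T. ?c w t * f t)" for f :: "nat \<Rightarrow> real" and w
    using fin by (intro sum.mono_neutral_cong_left) auto
  have cT: "(\<Sum>w | w \<in> W \<and> {w, t} \<in> R. f w) = (\<Sum>w\<in>W. ?c w t * f w)" for f :: "nat \<Rightarrow> real" and t
    using fin by (intro sum.mono_neutral_cong_left) auto
  \<comment> \<open>A random edge transports half of the squared deviation of \<open>t\<close>, at
    the price of the full squared deviation of \<open>w\<close>. The difference of the two sides is
    half of the square of \<open>2 * p - q\<close>.\<close>
  have pt: "?c w t * (v t / 2) - ?c w t * v w \<le> ?c w t * (x w - x t)\<^sup>2" for w t
  proof -
    have "q\<^sup>2 / 2 - p\<^sup>2 \<le> (p - q)\<^sup>2" for p q :: real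
      using zero_le_power2[of "2 * p - q"] by (simp add: power2_eq_square algebra_simps)
    from this[of "x t - a" "x w - a"] show ?thesis
      by (simp add: v_def)
  qed
  have "20 * (\<Sum>t\<in>T. v t) \<le> (\<Sum>t\<in>T. \<beta> * real (card {w \<in> W. {w, t} \<in> R}) * (v t / 2))"
    unfolding sum_distrib_left
  proof (rule sum_mono)
    fix t assume "t \<in> T"
    from mult_right_mono[OF deg_T[OF this], of "v t / 2"]
    show "20 * v t \<le> \<beta> * real (card {w \<in> W. {w, t} \<in> R}) * (v t / 2)"
      by (simp add: v_def)
  qed
  also have "\<dots> = \<beta> * (\<Sum>t\<in>T. \<Sum>w\<in>W. ?c w t * (v t / 2))"
    unfolding cT[symmetric] sum_distrib_left by (simp add: ac_simps)
  finally have 1: "20 * (\<Sum>t\<in>T. v t) \<le> \<beta> * (\<Sum>t\<in>T. \<Sum>w\<in>W. ?c w t * (v t / 2))" .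
  have "\<beta> * (\<Sum>w\<in>W. \<Sum>t\<in>T. ?c w t * v w) = (\<Sum>w\<in>W. \<beta> * real (card {t \<in> T. {w, t} \<in> R}) * v w)"
    unfolding cW[symmetric] sum_distrib_left by (simp add: ac_simps)
  also have "\<dots> \<le> (\<Sum>w\<in>W. v w)"
  proof (rule sum_mono)
    fix w assume "w \<in> W"
    from mult_right_mono[OF deg_W[OF this], of "v w"]
    show "\<beta> * real (card {t \<in> T. {w, t} \<in> R}) * v w \<le> v w"
      by (simp add: v_def)
  qed
  finally have 2: "\<beta> * (\<Sum>w\<in>W. \<Sum>t\<in>T. ?c w t * v w) \<le> (\<Sum>w\<in>W. v w)" .
  have "(\<Sum>t\<in>T. \<Sum>w\<in>W. ?c w t * (v t / 2)) - (\<Sum>w\<in>W. \<Sum>t\<in>T. ?c w t * v w)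
      = (\<Sum>w\<in>W. \<Sum>t\<in>T. ?c w t * (v t / 2) - ?c w t * v w)"
    by (subst sum.swap) (simp add: sum_subtractf)
  also have "\<dots> \<le> (\<Sum>w\<in>W. \<Sum>t\<in>T. ?c w t * (x w - x t)\<^sup>2)"
    by (intro sum_mono pt)
  finally have "\<beta> * ((\<Sum>t\<in>T. \<Sum>w\<in>W. ?c w t * (v t / 2)) - (\<Sum>w\<in>W. \<Sum>t\<in>T. ?c w t * v w))
      \<le> \<beta> * (\<Sum>w\<in>W. \<Sum>t\<in>T. ?c w t * (x w - x t)\<^sup>2)"
    using \<beta> by (rule mult_left_mono)
  moreover have "(\<Sum>w\<in>W. \<beta> * (\<Sum>t | t \<in> T \<and> {w, t} \<in> R. (x w - x t)\<^sup>2))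
      = \<beta> * (\<Sum>w\<in>W. \<Sum>t\<in>T. ?c w t * (x w - x t)\<^sup>2)"
    unfolding cW sum_distrib_left ..
  \<comment> \<open>After halving, the random edges yield 20/2 = 10 on \<open>T\<close> and cost 1/2
    on \<open>W\<close>, while the expander yields 9/10 there; 9/10 - 1/2 = 2/5.\<close>
  ultimately show ?thesis
    using 1 2 poincare by (simp add: v_def right_diff_distrib)
qed

lemma involution_bij_betw:
  assumes "\<And>t. t \<in> B \<Longrightarrow> f t \<in> B" "\<And>t. t \<in> B \<Longrightarrow> f (f t) = t"
  shows "bij_betw f B B"
  by (rule bij_betw_byWitness[where f' = f]) (use assms in auto)

text \<open>Since \<open>f\<close> permutes \<open>B\<close>, the first two sums differ by the sum of \<open>(x t + x (f t))\<^sup>2\<close>. This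
  vanishes on the planted solution, and as \<open>x\<close> sums to 0 it is otherwise controlled by the deviations
  from the means \<open>a\<close> and \<open>b\<close> over the two expanders.\<close>

lemma boundary_lower_bound:
  fixes x :: "nat \<Rightarrow> real"
  assumes fin: "finite S" "finite S'"
    and sub: "T \<subseteq> S" "T' \<subseteq> S'" and disj: "S \<inter> S' = {}"
    and cardS: "card S = card S'" "0 < card S"
    and small: "5 * (card T + card T') \<le> card S"
    and f: "\<And>t. t \<in> B \<Longrightarrow> f t \<in> B" "\<And>t. t \<in> B \<Longrightarrow> f (f t) = t"
      "\<And>t. t \<in> B \<Longrightarrow> t \<in> T \<and> f t \<in> T' \<or> t \<in> T' \<and> f t \<in> T"
    and sum0: "(\<Sum>i\<in>S \<union> S'. x i) = 0"
    and a: "(\<Sum>i\<in>S - T. x i - a) = 0" and b: "(\<Sum>i\<in>S' - T'. x i - b) = 0"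
  shows "4 * (\<Sum>t\<in>B. (x t)\<^sup>2) \<le> (\<Sum>t\<in>B. (x t - x (f t))\<^sup>2)
     + 9 * ((\<Sum>t\<in>T. (x t - a)\<^sup>2) + (\<Sum>t\<in>T'. (x t - b)\<^sup>2))"
proof -
  define v where "v i = (if i \<in> S then x i - a else x i - b)" for i
  have finT: "finite T" "finite T'"
    using fin sub by (auto intro: finite_subset)
  have BT: "B \<subseteq> T \<union> T'" using f(3) by auto
  have finB: "finite B" using BT finT by (auto intro: finite_subset)
  have disjT: "T \<inter> T' = {}" using sub disj by auto
  have vT: "v t = x t - a" if "t \<in> T" for t using that sub by (auto simp: v_def)
  have vT': "v t = x t - b" if "t \<in> T'" for t using that sub disj by (auto simp: v_def)
  define K where "K = (\<Sum>t\<in>T \<union> T'. (v t)\<^sup>2)"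
  have K: "K = (\<Sum>t\<in>T. (x t - a)\<^sup>2) + (\<Sum>t\<in>T'. (x t - b)\<^sup>2)"
    unfolding K_def by (subst sum.union_disjoint) (use finT disjT vT vT' in auto)
  have K0: "0 \<le> K" by (auto simp: K_def intro: sum_nonneg)
  define s where "s = real (card S)"
  have s0: "s > 0" using cardS by (simp add: s_def)
  have S1: "(\<Sum>i\<in>S. x i) = s * a + (\<Sum>t\<in>T. v t)"
  proof -
    have "(\<Sum>i\<in>S. x i - a) = (\<Sum>i\<in>S - T. x i - a) + (\<Sum>t\<in>T. x t - a)"
      using fin sub by (intro sum.subset_diff)
    then show ?thesis using a vT by (simp add: sum_subtractf s_def)
  qed
  have S2: "(\<Sum>i\<in>S'. x i) = s * b + (\<Sum>t\<in>T'. v t)"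
  proof -
    have "(\<Sum>i\<in>S'. x i - b) = (\<Sum>i\<in>S' - T'. x i - b) + (\<Sum>t\<in>T'. x t - b)"
      using fin sub by (intro sum.subset_diff)
    then show ?thesis using b vT' cardS by (simp add: sum_subtractf s_def)
  qed
  have "(\<Sum>i\<in>S. x i) + (\<Sum>i\<in>S'. x i) = 0"
    using sum0 fin disj by (simp add: sum.union_disjoint)
  \<comment> \<open>As both sides have size \<open>s\<close> and the total is 0, the two means
    cancel up to the deviations on \<open>T\<close> and \<open>T'\<close>, which are few.\<close>
  then have "s * (a + b) = - (\<Sum>t\<in>T \<union> T'. v t)"
    using S1 S2 disjT finT by (simp add: sum.union_disjoint algebra_simps)
  then have "(s * (a + b))\<^sup>2 = (\<Sum>t\<in>T \<union> T'. v t)\<^sup>2" by simp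
  also have "\<dots> \<le> real (card (T \<union> T')) * K"
    unfolding K_def
    using Cauchy_Schwarz_ineq_sum[of "\<lambda>_. 1" v "T \<union> T'"] by simp
  finally have ab: "s\<^sup>2 * (a + b)\<^sup>2 \<le> real (card (T \<union> T')) * K"
    by (simp add: power_mult_distrib)
  have cT: "5 * real (card (T \<union> T')) \<le> s"
    using small disjT finT by (simp add: card_Un_disjoint s_def)
  have cB: "real (card B) \<le> real (card (T \<union> T'))"
    using BT finT by (simp add: card_mono)
  have "s\<^sup>2 * (2 * real (card B) * (a + b)\<^sup>2) = 2 * real (card B) * (s\<^sup>2 * (a + b)\<^sup>2)" by simp
  also have "\<dots> \<le> 2 * (s / 5) * (s / 5 * K)"
    by (intro mult_mono order.trans[OF ab] mult_right_mono) (use cT cB K0 s0 in auto)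
  also have "\<dots> \<le> s\<^sup>2 * K"
    using K0 s0 by (simp add: power2_eq_square)
  \<comment> \<open>The bound \<open>s / 5\<close> enters twice, for \<open>card B\<close> and for
    the Cauchy-Schwarz factor, so even 2/25 would do as coefficient of \<open>K\<close>.\<close>
  finally have small_term: "2 * real (card B) * (a + b)\<^sup>2 \<le> K"
    using s0 by simp
  have bij: "bij_betw f B B"
    using f by (intro involution_bij_betw)
  have refl: "(\<Sum>t\<in>B. g (f t)) = (\<Sum>t\<in>B. g t)" for g :: "nat \<Rightarrow> real"
    using bij by (rule sum.reindex_bij_betw)
  have "4 * (\<Sum>t\<in>B. (x t)\<^sup>2) = 2 * (\<Sum>t\<in>B. (x t)\<^sup>2) + 2 * (\<Sum>t\<in>B. (x (f t))\<^sup>2)"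
    using refl[of "\<lambda>t. (x t)\<^sup>2"] by simp
  also have "\<dots> = (\<Sum>t\<in>B. (x t - x (f t))\<^sup>2 + (x t + x (f t))\<^sup>2)"
    unfolding sum_distrib_left sum.distrib[symmetric]
    by (intro sum.cong) (auto simp: power2_eq_square algebra_simps)
  also have "\<dots> = (\<Sum>t\<in>B. (x t - x (f t))\<^sup>2) + (\<Sum>t\<in>B. (x t + x (f t))\<^sup>2)"
    by (rule sum.distrib)
  also have "(\<Sum>t\<in>B. (x t + x (f t))\<^sup>2) \<le> (\<Sum>t\<in>B. 2 * (a + b)\<^sup>2 + 4 * (v t)\<^sup>2 + 4 * (v (f t))\<^sup>2)"
  proof (rule sum_mono)
    fix t assume "t \<in> B"
    then have "x t + x (f t) = (a + b) + (v t + v (f t))"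
      using f(3)[of t] vT vT' by auto
    moreover have "(p + (q + r))\<^sup>2 \<le> 2 * p\<^sup>2 + 4 * q\<^sup>2 + 4 * r\<^sup>2" for p q r :: real
      using zero_le_power2[of "p - (q + r)"] zero_le_power2[of "q - r"]
      by (simp add: power2_eq_square algebra_simps)
    ultimately show "(x t + x (f t))\<^sup>2 \<le> 2 * (a + b)\<^sup>2 + 4 * (v t)\<^sup>2 + 4 * (v (f t))\<^sup>2"
      by simp
  qed
  also have "\<dots> = 2 * real (card B) * (a + b)\<^sup>2 + 8 * (\<Sum>t\<in>B. (v t)\<^sup>2)"
    using refl[of "\<lambda>t. (v t)\<^sup>2"] by (simp add: sum.distrib sum_distrib_left[symmetric])
  also have "(\<Sum>t\<in>B. (v t)\<^sup>2) \<le> K"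
    unfolding K_def using BT finT by (intro sum_mono2) auto
  \<comment> \<open>The constant 9 is 8 from the deviations, each of which is met at
    \<open>t\<close> and at \<open>f t\<close> with coefficient 4, and 1 from
    \<open>small_term\<close>.\<close>
  finally show ?thesis
    using small_term unfolding K[symmetric] by simp
qed

section \<open>The spectral gap of a regular graph\<close>

text \<open>Counting entries that are at most \<open>max a b\<close>: the submultiset provides two,
  but if the second list entry were larger, only the head could qualify.\<close>

lemma sorted_list_of_multiset_nth_1_le:
  fixes a b :: "'a :: linorder"
  assumes "{#a, b#} \<subseteq># M"
  shows "sorted_list_of_multiset M ! 1 \<le> max a b"
proof (rule ccontr)
  define xs where "xs = sorted_list_of_multiset M"
  assume "\<not> sorted_list_of_multiset M ! 1 \<le> max a b"
  then have gt: "max a b < xs ! 1" unfolding xs_def not_le .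
  have M: "mset xs = M" and sorted: "sorted xs" by (simp_all add: xs_def)
  have "size {#a, b#} \<le> size (mset xs)"
    using assms unfolding M by (rule size_mset_mono)
  then have "Suc (Suc 0) \<le> length xs" by simp
  then obtain u v ys where xs: "xs = u # v # ys"
    by (auto simp: Suc_le_length_iff)
  have "filter_mset (\<lambda>z. z \<le> max a b) {#a, b#} \<subseteq># filter_mset (\<lambda>z. z \<le> max a b) M"
    using assms by (rule multiset_filter_mono)
  also have "filter_mset (\<lambda>z. z \<le> max a b) M = filter_mset (\<lambda>z. z \<le> max a b) {#u#}"
  proof -
    have "filter_mset (\<lambda>z. z \<le> max a b) (mset (v # ys)) = {#}"
      using sorted gt xs by (auto simp: filter_mset_eq_conv le_max_iff_disj)
    moreover have "M = {#u#} + mset (v # ys)"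
      using M xs by auto
    then have "filter_mset (\<lambda>z. z \<le> max a b) M =
        filter_mset (\<lambda>z. z \<le> max a b) {#u#} + filter_mset (\<lambda>z. z \<le> max a b) (mset (v # ys))"
      by (simp only: filter_union_mset)
    ultimately show ?thesis by (simp only: add_0_right)
  qed
  finally have "size (filter_mset (\<lambda>z. z \<le> max a b) {#a, b#}) \<le> size (filter_mset (\<lambda>z. z \<le> max a b) {#u#})"
    by (rule size_mset_mono)
  moreover have "size (filter_mset (\<lambda>z. z \<le> max a b) {#u#}) \<le> 1"
    by simp
  ultimately show False by simp
qed

text \<open>Deflation: the similarity transformation replacing the first unit vector by the all-ones
  vector splits off the eigenvalue 0, and an eigenvector \<open>y\<close> that is not constant survives in
  the remaining block. In this way the case \<open>\<nu> = 0\<close> of a double root needs no special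
  treatment.\<close>

lemma proots_char_poly_zero_row_sums:
  fixes N :: "real mat"
  assumes N: "N \<in> carrier_mat (Suc n) (Suc n)"
    and row: "\<And>i. i < Suc n \<Longrightarrow> (\<Sum>j<Suc n. N $$ (i, j)) = 0"
    and eigen: "\<And>i. i < Suc n \<Longrightarrow> (\<Sum>j<Suc n. N $$ (i, j) * y j) = \<nu> * y i"
    and y: "k < Suc n" "y k \<noteq> y 0"
  shows "{#0, \<nu>#} \<subseteq># proots (char_poly N)"
proof -
  define b where "b = mat 1 n (\<lambda>(_, j). N $$ (0, Suc j))"
  define A where "A = mat n n (\<lambda>(i, j). N $$ (Suc i, Suc j) - N $$ (0, Suc j))"
  define B where "B = four_block_mat (0\<^sub>m 1 1) b (0\<^sub>m n 1) A"
  \<comment> \<open>The columns of \<open>P\<close> are the all-ones vector and the unit vectors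
    other than the first; \<open>Q\<close> is the inverse of \<open>P\<close>, and \<open>B\<close>
    is \<open>Q * N * P\<close>.\<close>
  define P where "P = mat (Suc n) (Suc n) (\<lambda>(i, j). if j = 0 \<or> i = j then 1 else 0 :: real)"
  define Q where "Q = mat (Suc n) (Suc n) (\<lambda>(i, j). if i = j then 1 else if j = 0 then -1 else 0 :: real)"
  have carr: "b \<in> carrier_mat 1 n" "A \<in> carrier_mat n n" "B \<in> carrier_mat (Suc n) (Suc n)"
    "P \<in> carrier_mat (Suc n) (Suc n)" "Q \<in> carrier_mat (Suc n) (Suc n)"
    by (auto simp: b_def A_def B_def P_def Q_def)
  have B_entry: "B $$ (i, j) = (if j = 0 then 0 else if i = 0 then N $$ (0, j) else N $$ (i, j) - N $$ (0, j))"
    if "i < Suc n" "j < Suc n" for i j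
    using that by (cases i; cases j) (auto simp: B_def b_def A_def)
  have split: "(\<Sum>k\<in>{0..<Suc n}. f k) = f 0 + (\<Sum>k\<in>{0..<n}. f (Suc k))" for f :: "nat \<Rightarrow> real"
    by (simp add: sum.atLeast0_lessThan_Suc_shift o_def del: sum.op_ivl_Suc)
  have delta: "(\<Sum>k\<in>{0..<n}. if i = Suc k then f k else 0) = (if i = 0 then 0 else f (i - 1))"
    if "i < Suc n" for i and f :: "nat \<Rightarrow> real"
    using that by (cases i) auto
  have PQ: "P * Q = 1\<^sub>m (Suc n)"
  proof (rule eq_matI)
    fix i j assume "i < dim_row (1\<^sub>m (Suc n))" "j < dim_col (1\<^sub>m (Suc n))"
    then have ij: "i < Suc n" "j < Suc n" by auto
    have "(P * Q) $$ (i, j) = (\<Sum>k\<in>{0..<Suc n}. P $$ (i, k) * Q $$ (k, j))"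
      using ij by (simp add: P_def Q_def scalar_prod_def)
    also have "\<dots> = Q $$ (0, j) + (\<Sum>k\<in>{0..<n}. if i = Suc k then Q $$ (Suc k, j) else 0)"
      unfolding split using ij by (auto simp: P_def intro!: sum.cong)
    also have "\<dots> = (1\<^sub>m (Suc n)) $$ (i, j)"
      unfolding delta[OF ij(1)] using ij by (auto simp: Q_def)
    finally show "(P * Q) $$ (i, j) = (1\<^sub>m (Suc n)) $$ (i, j)" .
  qed (auto simp: P_def Q_def)
  have QP: "Q * P = 1\<^sub>m (Suc n)"
    by (rule mat_mult_left_right_inverse[OF carr(4,5) PQ])
  have PB: "P * B = mat (Suc n) (Suc n) (\<lambda>(i, j). if j = 0 then 0 else N $$ (i, j))" (is "_ = ?M")
  proof (rule eq_matI)
    fix i j assume "i < dim_row ?M" "j < dim_col ?M"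
    then have ij: "i < Suc n" "j < Suc n" by auto
    have "(P * B) $$ (i, j) = (\<Sum>k\<in>{0..<Suc n}. P $$ (i, k) * B $$ (k, j))"
      using ij carr by (simp add: P_def scalar_prod_def)
    also have "\<dots> = B $$ (0, j) + (\<Sum>k\<in>{0..<n}. if i = Suc k then B $$ (Suc k, j) else 0)"
      unfolding split using ij by (auto simp: P_def intro!: sum.cong)
    also have "\<dots> = ?M $$ (i, j)"
      unfolding delta[OF ij(1)] using ij by (auto simp: B_entry)
    finally show "(P * B) $$ (i, j) = ?M $$ (i, j)" .
  qed (use carr in auto)
  have "P * B * Q = N"
  proof (rule eq_matI)
    fix i j assume "i < dim_row N" "j < dim_col N"
    then have ij: "i < Suc n" "j < Suc n" using N by auto
    have "(P * B * Q) $$ (i, j) = (\<Sum>k\<in>{0..<Suc n}. ?M $$ (i, k) * Q $$ (k, j))"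
      using ij unfolding PB by (simp add: Q_def scalar_prod_def)
    also have "\<dots> = (\<Sum>k\<in>{0..<n}. N $$ (i, Suc k) * Q $$ (Suc k, j))"
      unfolding split using ij by (auto intro!: sum.cong)
    also have "\<dots> = N $$ (i, j)"
    proof (cases "j = 0")
      case True
      have "(\<Sum>k\<in>{0..<n}. N $$ (i, Suc k) * Q $$ (Suc k, j)) = - (\<Sum>k\<in>{0..<n}. N $$ (i, Suc k))"
        using True ij by (auto simp: Q_def sum_negf[symmetric] intro!: sum.cong)
      moreover have "N $$ (i, 0) + (\<Sum>k\<in>{0..<n}. N $$ (i, Suc k)) = 0"
        using row[OF ij(1)] split[of "\<lambda>k. N $$ (i, k)"]
        by (simp add: atLeast0LessThan del: sum.lessThan_Suc)
      ultimately show ?thesis using True by simp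
    next
      case False
      have "(\<Sum>k\<in>{0..<n}. N $$ (i, Suc k) * Q $$ (Suc k, j)) =
          (\<Sum>k\<in>{0..<n}. if j = Suc k then N $$ (i, Suc k) else 0)"
        using False ij by (auto simp: Q_def intro!: sum.cong)
      then show ?thesis unfolding delta[OF ij(2)] using False by simp
    qed
    finally show "(P * B * Q) $$ (i, j) = N $$ (i, j)" .
  qed (use N carr in auto)
  then have "similar_mat N B"
    using carr N PQ QP by (intro similar_matI[of _ _ P Q "Suc n"]) auto
  then have "char_poly N = char_poly B"
    by (rule char_poly_similar)
  also have "\<dots> = char_poly (0\<^sub>m 1 1 :: real mat) * char_poly A"
    unfolding B_def by (rule char_poly_four_block_zeros_col) (use carr in auto)
  also have "char_poly (0\<^sub>m 1 1 :: real mat) = [:0, 1:]"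
    by (simp add: char_poly_def char_poly_matrix_def det_single)
  finally have cp: "char_poly N = [:0, 1:] * char_poly A" .
  have A0: "char_poly A \<noteq> 0"
    using degree_monic_char_poly[OF carr(2)] by auto
  \<comment> \<open>This is \<open>Q\<close> applied to \<open>y\<close>, without its entry 0. It is
    nonzero because \<open>y k\<close> differs from \<open>y 0\<close>.\<close>
  define z where "z = Matrix.vec n (\<lambda>i. y (Suc i) - y 0)"
  have "eigenvector A z \<nu>"
    unfolding eigenvector_def
  proof (intro conjI)
    show "z \<in> carrier_vec (dim_row A)" using carr by (auto simp: z_def)
    obtain k' where k': "k = Suc k'" using y by (cases k) auto
    have "z $ k' \<noteq> 0" "k' < n" using y k' by (auto simp: z_def)
    then show "z \<noteq> 0\<^sub>v (dim_row A)" using carr by auto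
    show "A *\<^sub>v z = \<nu> \<cdot>\<^sub>v z"
    proof (rule eq_vecI)
      fix i assume "i < dim_vec (\<nu> \<cdot>\<^sub>v z)"
      then have i: "i < n" by (simp add: z_def)
      have shift: "(\<Sum>k\<in>{0..<n}. N $$ (l, Suc k) * (y (Suc k) - y 0)) = \<nu> * y l"
        if "l < Suc n" for l
      proof -
        have "(\<Sum>k\<in>{0..<n}. N $$ (l, Suc k) * (y (Suc k) - y 0)) =
            (\<Sum>k\<in>{0..<Suc n}. N $$ (l, k) * (y k - y 0))"
          unfolding split by simp
        also have "\<dots> = (\<Sum>k\<in>{0..<Suc n}. N $$ (l, k) * y k) - (\<Sum>k\<in>{0..<Suc n}. N $$ (l, k)) * y 0"
          by (simp add: right_diff_distrib sum_subtractf sum_distrib_right del: sum.op_ivl_Suc)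
        also have "\<dots> = \<nu> * y l"
          using row[OF that] eigen[OF that] by (simp add: atLeast0LessThan del: sum.lessThan_Suc)
        finally show ?thesis .
      qed
      have "(A *\<^sub>v z) $ i = (\<Sum>k\<in>{0..<n}. (N $$ (Suc i, Suc k) - N $$ (0, Suc k)) * (y (Suc k) - y 0))"
        using i carr by (simp add: scalar_prod_def A_def z_def)
      also have "\<dots> = \<nu> * y (Suc i) - \<nu> * y 0"
        using shift[of "Suc i"] shift[of 0] i by (simp add: left_diff_distrib sum_subtractf)
      finally show "(A *\<^sub>v z) $ i = (\<nu> \<cdot>\<^sub>v z) $ i"
        using i by (simp add: z_def right_diff_distrib)
    qed (use carr in \<open>auto simp: z_def\<close>)
  qed
  then have "poly (char_poly A) \<nu> = 0"
    using eigenvalue_root_char_poly[OF carr(2)] by (auto simp: eigenvalue_def)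
  then have "\<nu> \<in># proots (char_poly A)"
    using A0 by simp
  moreover have "proots (char_poly N) = {#0#} + proots (char_poly A)"
    unfolding cp using A0 by (subst proots_mult) auto
  ultimately show ?thesis
    by (simp add: mset_subset_eq_single)
qed

text \<open>The minimum of the quadratic form over zero-sum unit vectors is attained by compactness,
  and first-order optimality gives the eigenvector equation. The zero-sum constraint contributes no
  multiplier, because symmetric matrices with zero row sums map into the zero-sum vectors.\<close>

lemma rayleigh_minimizer:
  fixes N :: "nat \<Rightarrow> nat \<Rightarrow> real"
  assumes m: "2 \<le> m"
    and sym: "\<And>i j. i < m \<Longrightarrow> j < m \<Longrightarrow> N i j = N j i"
    and row: "\<And>i. i < m \<Longrightarrow> (\<Sum>j<m. N i j) = 0"
  shows "\<exists>\<nu> y. (\<Sum>i<m. y i) = 0 \<and> (\<Sum>i<m. (y i)\<^sup>2) = 1 \<and>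
    (\<forall>i<m. (\<Sum>j<m. N i j * y j) = \<nu> * y i) \<and>
    (\<forall>x. (\<Sum>i<m. x i) = 0 \<longrightarrow> \<nu> * (\<Sum>i<m. (x i)\<^sup>2) \<le> (\<Sum>i<m. \<Sum>j<m. x i * x j * N i j))"
proof -
  define q where "q x = (\<Sum>i<m. \<Sum>j<m. x i * x j * N i j)" for x :: "nat \<Rightarrow> real"
  \<comment> \<open>Vectors are functions on all of \<open>nat\<close>. Fixing the coordinates from
    \<open>m\<close> on to 0 makes the box compact in the product topology.\<close>
  define C where "C i = (if i < m then {-1..1} else {0::real})" for i
  define K where "K = (PiE UNIV C \<inter> {x. (\<Sum>i<m. x i) = 0}) \<inter> {x. (\<Sum>i<m. (x i)\<^sup>2) = 1}"
  have cont: "continuous_on X (\<lambda>x. x i)" for X and i :: nat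
    by (rule continuous_on_subset[OF continuous_on_product_coordinates]) simp
  have "compactin (product_topology (\<lambda>i. euclidean) UNIV) (PiE UNIV C)"
    unfolding compactin_PiE by (auto simp: C_def)
  then have "compact (PiE UNIV C)"
    by (simp add: euclidean_product_topology)
  moreover have "closed {x :: nat \<Rightarrow> real. (\<Sum>i<m. x i) = 0}" "closed {x :: nat \<Rightarrow> real. (\<Sum>i<m. (x i)\<^sup>2) = 1}"
    by (intro closed_Collect_eq continuous_intros cont)+
  ultimately have "compact K"
    unfolding K_def by (intro compact_Int_closed)
  moreover have scale: "(\<lambda>i. if i < m then x i / sqrt (\<Sum>i<m. (x i)\<^sup>2) else 0) \<in> K"
    if "(\<Sum>i<m. x i) = 0" "(\<Sum>i<m. (x i)\<^sup>2) > 0" for x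
  proof -
    define s where "s = (\<Sum>i<m. (x i)\<^sup>2)"
    have s: "s > 0" using that by (simp add: s_def)
    have "(\<Sum>i<m. (x i / sqrt s)\<^sup>2) = s / s"
      using s by (simp add: power_divide sum_divide_distrib[symmetric] s_def[symmetric])
    moreover have "(\<Sum>i<m. x i / sqrt s) = 0"
      using that by (simp add: sum_divide_distrib[symmetric])
    moreover have "-1 \<le> x i / sqrt s \<and> x i / sqrt s \<le> 1" if "i < m" for i
    proof -
      have "(x i)\<^sup>2 \<le> s"
        unfolding s_def using that by (intro member_le_sum) auto
      then have "\<bar>x i\<bar> \<le> sqrt s" by (metis real_sqrt_abs real_sqrt_le_iff)
      then show ?thesis using s by (auto simp: field_simps abs_le_iff)
    qed
    ultimately show ?thesis
      using s unfolding s_def[symmetric] K_def C_def by (auto simp: PiE_iff)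
  qed
  moreover have "K \<noteq> {}"
  proof -
    define e where "e i = (if i = 0 then 1 else if i = Suc 0 then -1 else 0 :: real)" for i :: nat
    have "{..<m} = insert 0 (insert 1 {2..<m})" using m by auto
    then have "(\<Sum>i<m. e i) = 0" "(\<Sum>i<m. (e i)\<^sup>2) = 2"
      by (simp_all add: e_def)
    then show ?thesis using scale[of e] by auto
  qed
  moreover have "continuous_on K q"
    unfolding q_def by (intro continuous_intros cont)
  ultimately obtain y where y: "y \<in> K" and min: "\<And>x. x \<in> K \<Longrightarrow> q y \<le> q x"
    using continuous_attains_inf[of K q] by blast
  define \<nu> where "\<nu> = q y"
  have y0: "(\<Sum>i<m. y i) = 0" and y1: "(\<Sum>i<m. (y i)\<^sup>2) = 1"
    using y by (auto simp: K_def)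
  have ge: "\<nu> * (\<Sum>i<m. (x i)\<^sup>2) \<le> q x" if x: "(\<Sum>i<m. x i) = 0" for x
  proof (cases "(\<Sum>i<m. (x i)\<^sup>2) = 0")
    case True
    then have "x i = 0" if "i < m" for i
      using that by (simp add: sum_nonneg_eq_0_iff)
    then show ?thesis by (simp add: q_def)
  next
    case False
    define s where "s = (\<Sum>i<m. (x i)\<^sup>2)"
    have s: "s > 0"
      using False sum_nonneg[of "{..<m}" "\<lambda>i. (x i)\<^sup>2"] by (simp add: s_def)
    have "\<nu> \<le> q (\<lambda>i. if i < m then x i / sqrt s else 0)"
      unfolding \<nu>_def by (intro min scale[OF x, folded s_def] s)
    also have "\<dots> = q x / s"
      unfolding q_def sum_divide_distrib using s by (intro sum.cong) auto
    finally show ?thesis using s by (simp add: s_def[symmetric] field_simps)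
  qed
  \<comment> \<open>The residual of the eigenvector equation. It sums to 0, so
    \<open>y + t * r\<close> is an admissible variation, and the derivative of the Rayleigh
    inequality along it is twice the squared norm \<open>d\<close> of the residual.\<close>
  define r where "r i = (\<Sum>j<m. N i j * y j) - \<nu> * y i" for i
  have r0: "(\<Sum>i<m. r i) = 0"
  proof -
    have "(\<Sum>i<m. \<Sum>j<m. N i j * y j) = (\<Sum>j<m. (\<Sum>i<m. N j i) * y j)"
      by (subst sum.swap) (use sym in \<open>auto simp: sum_distrib_right intro!: sum.cong\<close>)
    then show ?thesis
      using row y0 by (simp add: r_def sum_subtractf sum_distrib_left[symmetric])
  qed
  define c where "c = q r - \<nu> * (\<Sum>i<m. (r i)\<^sup>2)"
  define d where "d = (\<Sum>i<m. (r i)\<^sup>2)"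
  have expand: "q (\<lambda>i. y i + t * r i) - \<nu> * (\<Sum>i<m. (y i + t * r i)\<^sup>2) = 2 * t * d + t\<^sup>2 * c" for t
  proof -
    have 1: "(\<Sum>i<m. \<Sum>j<m. y i * r j * N i j) = (\<Sum>i<m. \<Sum>j<m. r i * y j * N i j)"
      by (subst sum.swap) (use sym in \<open>auto intro!: sum.cong\<close>)
    have "q (\<lambda>i. y i + t * r i) = q y + t * (\<Sum>i<m. \<Sum>j<m. y i * r j * N i j)
        + t * (\<Sum>i<m. \<Sum>j<m. r i * y j * N i j) + t\<^sup>2 * q r"
      by (simp add: q_def sum_distrib_left sum.distrib[symmetric] algebra_simps power2_eq_square)
    moreover have "(\<Sum>i<m. (y i + t * r i)\<^sup>2) = 1 + 2 * t * (\<Sum>i<m. r i * y i) + t\<^sup>2 * d"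
      unfolding y1[symmetric] d_def
      by (simp add: sum_distrib_left sum.distrib[symmetric] algebra_simps power2_eq_square)
    moreover have "(\<Sum>i<m. \<Sum>j<m. r i * y j * N i j) - \<nu> * (\<Sum>i<m. r i * y i) = d"
    proof -
      have "d = (\<Sum>i<m. r i * ((\<Sum>j<m. N i j * y j) - \<nu> * y i))"
        by (simp add: d_def r_def power2_eq_square)
      then show ?thesis
        by (simp add: right_diff_distrib sum_subtractf sum_distrib_left ac_simps)
    qed
    ultimately show ?thesis
      unfolding 1 by (simp add: c_def d_def[symmetric] \<nu>_def[symmetric] algebra_simps)
  qed
  have nonneg: "0 \<le> 2 * t * d + t\<^sup>2 * c" for t
    using ge[of "\<lambda>i. y i + t * r i"] y0 r0 expand[of t]
    by (simp add: sum.distrib sum_distrib_left[symmetric])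
  have "d = 0"
  proof (rule ccontr)
    assume "d \<noteq> 0"
    then have d: "d > 0" using sum_nonneg[of "{..<m}" "\<lambda>i. (r i)\<^sup>2"] by (simp add: d_def)
    \<comment> \<open>Negative and so small that the linear term outweighs the quadratic one,
      whatever the sign of \<open>c\<close>.\<close>
    define t where "t = - d / (\<bar>c\<bar> + 1)"
    have "t < 0" using d by (simp add: t_def divide_neg_pos)
    have "\<bar>t\<bar> * \<bar>c\<bar> < 2 * d"
      using d add_nonneg_pos[of "d * \<bar>c\<bar>" "d * 2"] by (simp add: t_def abs_divide field_simps)
    then have "2 * d + t * c > 0"
      by (simp add: abs_mult[symmetric] abs_less_iff)
    with \<open>t < 0\<close> have "t * (2 * d + t * c) < 0" by (rule mult_neg_pos)
    with nonneg[of t] show False by (simp add: algebra_simps power2_eq_square)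
  qed
  then have "r i = 0" if "i < m" for i
    using that by (simp add: d_def sum_nonneg_eq_0_iff)
  then have "(\<Sum>j<m. N i j * y j) = \<nu> * y i" if "i < m" for i
    using that by (simp add: r_def)
  with y0 y1 ge show ?thesis
    unfolding q_def by blast
qed

text \<open>The Rayleigh minimiser over zero-sum vectors is a nonconstant eigenvector, so deflation
  exhibits 0 and \<open>\<nu>\<close> as two roots and bounds the second smallest root by their
  maximum. The factor 2 arises because each edge is counted from both of its ends.\<close>

lemma spectral_gap_poincare:
  fixes x :: "nat \<Rightarrow> real"
  assumes fin: "finite W" and H: "H \<subseteq> pairs W"
    and deg: "\<And>w. w \<in> W \<Longrightarrow> vdegree H w = d" and d: "0 < d"
    and gap: "l \<le> spectral_gap W H" and l: "0 < l"
    and mean: "(\<Sum>w\<in>W. x w - a) = 0"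
  shows "2 * l * (\<Sum>w\<in>W. (x w - a)\<^sup>2) \<le> (\<Sum>w\<in>W. (\<Sum>j\<in>nbrs H w. (x w - x j)\<^sup>2) / d)"
proof (cases "W = {}")
  case True
  then show ?thesis by simp
next
  case False
  define vs where "vs = sorted_list_of_set W"
  define m where "m = card W"
  \<comment> \<open>For a \<open>d\<close>-regular graph the normalized Laplacian is the identity
    minus the adjacency matrix over \<open>d\<close>; \<open>k\<close> is this kernel indexed by
    vertices instead of list positions.\<close>
  define k where "k u w = (if u = w then 1 else 0) - (if {u, w} \<in> H then 1 / real d else 0)" for u w
  have vs: "set vs = W" "distinct vs" "length vs = m"
    using fin by (simp_all add: vs_def m_def)
  have bij: "bij_betw (\<lambda>i. vs ! i) {..<m} W"
    using vs by (intro bij_betw_nth) auto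
  have nbrs: "nbrs H w \<subseteq> W" "w \<notin> nbrs H w" "nbrs H w = {j \<in> W. {w, j} \<in> H}" for w
    using H by (auto simp: nbrs_def pairs_def doubleton_eq_iff subset_iff)
  have "2 \<le> m"
  proof -
    obtain w where w: "w \<in> W" using False by auto
    then have "nbrs H w \<noteq> {}" using deg[OF w] d by (auto simp: vdegree_def)
    then obtain u where "u \<in> nbrs H w" by auto
    then have "{u, w} \<subseteq> W" "u \<noteq> w" using nbrs w by auto
    then show ?thesis
      using card_mono[OF fin, of "{u, w}"] by (simp add: m_def)
  qed
  have sum_W: "(\<Sum>i<m. f (vs ! i)) = (\<Sum>w\<in>W. f w)" for f :: "nat \<Rightarrow> real"
    using bij by (rule sum.reindex_bij_betw)
  have sum_nbrs: "(\<Sum>u\<in>W. if {w, u} \<in> H then f u else 0) = (\<Sum>u\<in>nbrs H w. f u)"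
    for f :: "nat \<Rightarrow> real" and w
    unfolding nbrs(3)[of w] using fin by (simp add: sum.inter_filter)
  have row_W: "(\<Sum>u\<in>W. k w u) = 0" if "w \<in> W" for w
  proof -
    have "(\<Sum>u\<in>W. k w u) = 1 - (\<Sum>u\<in>nbrs H w. 1 / real d)"
      unfolding k_def sum_subtractf sum_nbrs using fin that by (simp add: sum.delta')
    then show ?thesis using deg[OF that] d by (simp add: vdegree_def)
  qed
  have entry: "normalized_laplacian W H = mat m m (\<lambda>(i, j). k (vs ! i) (vs ! j))"
  proof (rule eq_matI)
    fix i j
    assume "i < dim_row (mat m m (\<lambda>(i, j). k (vs ! i) (vs ! j)))"
      "j < dim_col (mat m m (\<lambda>(i, j). k (vs ! i) (vs ! j)))"
    then have ij: "i < m" "j < m" by auto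
    then have "vs ! i \<in> W" "vs ! j \<in> W" using vs by auto
    then have "sqrt (real (vdegree H (vs ! i))) * sqrt (real (vdegree H (vs ! j))) = real d"
      using deg by simp
    then show "normalized_laplacian W H $$ (i, j) = mat m m (\<lambda>(i, j). k (vs ! i) (vs ! j)) $$ (i, j)"
      using ij vs
      by (simp add: normalized_laplacian_def inv_sqrt_degree_mat_def adjacency_mat_def Let_def
          vs_def[symmetric] m_def[symmetric] k_def nth_eq_iff_index_eq
          mat_diag_mult_left[of _ m m] mat_diag_mult_right[of _ m m])
  qed (auto simp: normalized_laplacian_def inv_sqrt_degree_mat_def m_def Let_def mat_diag_def)
  have "k (vs ! i) (vs ! j) = k (vs ! j) (vs ! i)" for i j
    by (auto simp: k_def insert_commute)
  moreover have "(\<Sum>j<m. k (vs ! i) (vs ! j)) = 0" if "i < m" for i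
    using sum_W[of "k (vs ! i)"] row_W[of "vs ! i"] that vs by auto
  ultimately have "\<exists>\<nu> y. (\<Sum>i<m. y i) = 0 \<and> (\<Sum>i<m. (y i)\<^sup>2) = 1 \<and>
      (\<forall>i<m. (\<Sum>j<m. k (vs ! i) (vs ! j) * y j) = \<nu> * y i) \<and>
      (\<forall>x. (\<Sum>i<m. x i) = 0 \<longrightarrow>
        \<nu> * (\<Sum>i<m. (x i)\<^sup>2) \<le> (\<Sum>i<m. \<Sum>j<m. x i * x j * k (vs ! i) (vs ! j)))"
    by (intro rayleigh_minimizer \<open>2 \<le> m\<close>)
  then obtain \<nu> y where y: "(\<Sum>i<m. y i) = 0" "(\<Sum>i<m. (y i)\<^sup>2) = 1"
    and eigen: "\<And>i. i < m \<Longrightarrow> (\<Sum>j<m. k (vs ! i) (vs ! j) * y j) = \<nu> * y i"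
    and ray: "\<And>x. (\<Sum>i<m. x i) = 0 \<Longrightarrow>
      \<nu> * (\<Sum>i<m. (x i)\<^sup>2) \<le> (\<Sum>i<m. \<Sum>j<m. x i * x j * k (vs ! i) (vs ! j))"
    by blast
  have "l \<le> \<nu>"
  proof -
    obtain n where n: "m = Suc n" using \<open>2 \<le> m\<close> by (cases m) auto
    have "\<exists>i<m. y i \<noteq> y 0"
    proof (rule ccontr)
      assume "\<not> ?thesis"
      then obtain u where "\<forall>i\<in>{..<m}. y i = u" by blast
      then have "(\<Sum>i<m. y i) = real m * u" "(\<Sum>i<m. (y i)\<^sup>2) = real m * u\<^sup>2"
        by simp_all
      with y show False by auto
    qed
    then obtain i where i: "i < m" "y i \<noteq> y 0" by blast
    have "{#0, \<nu>#} \<subseteq># proots (char_poly (normalized_laplacian W H))"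
    proof (rule proots_char_poly_zero_row_sums[where y = y and k = i and n = n])
      show "normalized_laplacian W H \<in> carrier_mat (Suc n) (Suc n)"
        unfolding entry n by simp
      show "i < Suc n" "y i \<noteq> y 0" using i n by auto
      fix i assume i: "i < Suc n"
      show "(\<Sum>j<Suc n. normalized_laplacian W H $$ (i, j)) = 0"
        using i sum_W[of "k (vs ! i)"] row_W[of "vs ! i"] vs unfolding entry n[symmetric] by auto
      show "(\<Sum>j<Suc n. normalized_laplacian W H $$ (i, j) * y j) = \<nu> * y i"
        using i eigen[of i] unfolding entry n[symmetric] by simp
    qed
    \<comment> \<open>Since \<open>l\<close> is positive, the maximum cannot be 0, which leaves
      \<open>l \<le> \<nu>\<close>.\<close>
    then have "spectral_gap W H \<le> max 0 \<nu>"
      unfolding spectral_gap_def by (rule sorted_list_of_multiset_nth_1_le)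
    with gap l show ?thesis by simp
  qed
  define z where "z w = x w - a" for w
  define Z where "Z = (\<Sum>w\<in>W. (z w)\<^sup>2)"
  have "Z \<ge> 0" by (simp add: Z_def sum_nonneg)
  define c where "c = (\<Sum>w\<in>W. \<Sum>u\<in>nbrs H w. z w * z u)"
  have "\<nu> * Z \<le> (\<Sum>i<m. \<Sum>j<m. z (vs ! i) * z (vs ! j) * k (vs ! i) (vs ! j))"
    using ray[of "\<lambda>i. z (vs ! i)"] sum_W[of z] sum_W[of "\<lambda>w. (z w)\<^sup>2"] mean
    by (simp add: z_def Z_def)
  also have "\<dots> = (\<Sum>w\<in>W. \<Sum>u\<in>W. z w * z u * k w u)"
    unfolding sum_W[of "\<lambda>u. z (vs ! i) * z u * k (vs ! i) u" for i]
    by (rule sum_W)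
  also have "\<dots> = (\<Sum>w\<in>W. (z w)\<^sup>2 - (\<Sum>u\<in>nbrs H w. z w * z u) / d)"
  proof (rule sum.cong)
    fix w assume w: "w \<in> W"
    have "(\<Sum>u\<in>W. z w * z u * k w u) = (\<Sum>u\<in>W. (if w = u then z w * z u else 0) -
        (if {w, u} \<in> H then z w * z u / d else 0))"
      by (intro sum.cong) (auto simp: k_def right_diff_distrib)
    also have "\<dots> = z w * z w - (\<Sum>u\<in>nbrs H w. z w * z u / d)"
      unfolding sum_subtractf sum_nbrs using w fin by (simp add: sum.delta')
    finally show "(\<Sum>u\<in>W. z w * z u * k w u) = (z w)\<^sup>2 - (\<Sum>u\<in>nbrs H w. z w * z u) / d"
      by (simp add: power2_eq_square sum_divide_distrib)
  qed simp
  also have "\<dots> = Z - c / d"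
    by (simp add: Z_def c_def sum_subtractf sum_divide_distrib)
  finally have 1: "\<nu> * Z \<le> Z - c / d" .
  have "(x w - x u)\<^sup>2 = (z w)\<^sup>2 + (z u)\<^sup>2 - 2 * (z w * z u)" for w u
    by (simp add: z_def power2_eq_square algebra_simps)
  then have "(\<Sum>w\<in>W. \<Sum>u\<in>nbrs H w. (x w - x u)\<^sup>2) =
      (\<Sum>w\<in>W. \<Sum>u\<in>nbrs H w. (z w)\<^sup>2) + (\<Sum>w\<in>W. \<Sum>u\<in>nbrs H w. (z u)\<^sup>2) - 2 * c"
    by (simp only: c_def sum.distrib sum_subtractf sum_distrib_left)
  \<comment> \<open>Adjacency is symmetric, so the order of summation may be exchanged.\<close>
  also have "(\<Sum>w\<in>W. \<Sum>u\<in>nbrs H w. (z u)\<^sup>2) = (\<Sum>w\<in>W. \<Sum>u\<in>nbrs H w. (z w)\<^sup>2)"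
    unfolding sum_nbrs[symmetric] by (subst sum.swap) (simp add: insert_commute)
  also have "(\<Sum>w\<in>W. \<Sum>u\<in>nbrs H w. (z w)\<^sup>2) = d * Z"
    using deg by (simp add: vdegree_def Z_def sum_distrib_left)
  finally have "(\<Sum>w\<in>W. (\<Sum>u\<in>nbrs H w. (x w - x u)\<^sup>2) / d) = 2 * (Z - c / d)"
    using d by (simp add: sum_divide_distrib[symmetric] field_simps)
  moreover have "l * Z \<le> \<nu> * Z"
    using \<open>l \<le> \<nu>\<close> \<open>Z \<ge> 0\<close> by (rule mult_right_mono)
  ultimately show ?thesis
    using 1 by (simp add: Z_def z_def)
qed

section \<open>Degrees of the random edges\<close>

text \<open>The exponential of a sum of independent indicators factorises over \<open>I\<close>,
  with factor 1 outside the image of \<open>g\<close>. Each other factor has mean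
  \<open>1 + p * (exp s - 1)\<close>, and \<open>1 + x \<le> exp x\<close>. The success probability
  is fixed on this image only, since the product measure carries different probabilities on the two
  sides.\<close>

lemma
  fixes I :: "'b set" and g :: "'a \<Rightarrow> 'b" and s :: real
  assumes fin: "finite I" and g: "inj_on g Z" "g ` Z \<subseteq> I"
    and P: "\<And>z. z \<in> Z \<Longrightarrow> P (g z) = p" and p: "0 \<le> p" "p \<le> 1"
  shows integrable_exp_card_Pi_bernoulli:
      "integrable (measure_pmf (Pi_pmf I False (\<lambda>e. bernoulli_pmf (P e))))
         (\<lambda>\<omega>. exp (s * real (card {z \<in> Z. \<omega> (g z)})))" (is ?int)
    and expectation_exp_card_Pi_bernoulli_le:
      "measure_pmf.expectation (Pi_pmf I False (\<lambda>e. bernoulli_pmf (P e)))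
         (\<lambda>\<omega>. exp (s * real (card {z \<in> Z. \<omega> (g z)}))) \<le> exp (p * real (card Z) * (exp s - 1))" (is ?exp)
proof -
  let ?f = "\<lambda>e b. if e \<in> g ` Z \<and> b then exp s else 1 :: real"
  have finZ: "finite Z"
    using g fin by (meson finite_imageD finite_subset)
  have eq: "exp (s * real (card {z \<in> Z. \<omega> (g z)})) = (\<Prod>e\<in>I. ?f e (\<omega> e))" for \<omega>
  proof -
    have "(\<Prod>e\<in>I. ?f e (\<omega> e)) = (\<Prod>e\<in>g ` Z. ?f e (\<omega> e))"
      using fin g by (intro prod.mono_neutral_right) auto
    also have "\<dots> = (\<Prod>z\<in>Z. if \<omega> (g z) then exp s else 1)"
      using g by (subst prod.reindex) auto
    also have "\<dots> = (\<Prod>z | z \<in> Z \<and> \<omega> (g z). exp s)"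
      using finZ by (subst prod.inter_filter) auto
    finally show ?thesis by (simp add: exp_of_nat_mult[symmetric] mult.commute)
  qed
  have int: "integrable (measure_pmf (bernoulli_pmf (P e))) (?f e)" for e
    by (rule integrable_measure_pmf_finite) simp
  show ?int
    unfolding eq using fin int by (intro integrable_prod_Pi_pmf) auto
  have "measure_pmf.expectation (Pi_pmf I False (\<lambda>e. bernoulli_pmf (P e)))
       (\<lambda>\<omega>. exp (s * real (card {z \<in> Z. \<omega> (g z)}))) =
      (\<Prod>e\<in>I. measure_pmf.expectation (bernoulli_pmf (P e)) (?f e))"
    unfolding eq using fin int by (intro expectation_prod_Pi_pmf) auto
  also have "\<dots> = (\<Prod>e\<in>g ` Z. measure_pmf.expectation (bernoulli_pmf (P e)) (?f e))"
    using fin g by (intro prod.mono_neutral_right) auto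
  also have "\<dots> = (\<Prod>z\<in>Z. measure_pmf.expectation (bernoulli_pmf p) (\<lambda>b. if b then exp s else 1))"
    using g P by (subst prod.reindex) (auto intro!: prod.cong)
  also have "measure_pmf.expectation (bernoulli_pmf p) (\<lambda>b. if b then exp s else 1) = 1 + p * (exp s - 1)"
    using p by (simp add: algebra_simps)
  also have "(\<Prod>z\<in>Z. 1 + p * (exp s - 1)) \<le> (\<Prod>z\<in>Z. exp (p * (exp s - 1)))"
  proof (rule prod_mono)
    have "0 \<le> (1 - p) + p * exp s" using p by simp
    then show "0 \<le> 1 + p * (exp s - 1) \<and> 1 + p * (exp s - 1) \<le> exp (p * (exp s - 1))"
      using exp_ge_add_one_self[of "p * (exp s - 1)"] by (simp add: algebra_simps)
  qed
  also have "\<dots> = exp (p * real (card Z) * (exp s - 1))"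
    by (simp add: exp_of_nat_mult[symmetric] ac_simps)
  finally show ?exp .
qed

text \<open>Chernoff bounds with the exponential parameter fixed to \<open>1\<close> and \<open>-1\<close>, which is why the
  first is useful only for \<open>\<theta>\<close> above and the second only for \<open>\<theta>\<close> below a multiple of the mean.\<close>

lemma
  fixes I :: "'b set" and g :: "'a \<Rightarrow> 'b"
  assumes fin: "finite I" and g: "inj_on g Z" "g ` Z \<subseteq> I"
    and P: "\<And>z. z \<in> Z \<Longrightarrow> P (g z) = p" and p: "0 \<le> p" "p \<le> 1"
  shows prob_card_ge_le: "measure_pmf.prob (Pi_pmf I False (\<lambda>e. bernoulli_pmf (P e)))
      {\<omega>. \<theta> \<le> real (card {z \<in> Z. \<omega> (g z)})} \<le> exp (2 * (p * real (card Z)) - \<theta>)" (is ?upper)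
    and prob_card_le_le: "measure_pmf.prob (Pi_pmf I False (\<lambda>e. bernoulli_pmf (P e)))
      {\<omega>. real (card {z \<in> Z. \<omega> (g z)}) \<le> \<theta>} \<le> exp (\<theta> - p * real (card Z) / 2)" (is ?lower)
proof -
  define M where "M = Pi_pmf I False (\<lambda>e. bernoulli_pmf (P e))"
  define X where "X \<omega> = real (card {z \<in> Z. \<omega> (g z)})" for \<omega>
  define \<mu> where "\<mu> = p * real (card Z)"
  have "0 \<le> \<mu>" using p by (simp add: \<mu>_def)
  \<comment> \<open>With the factor \<open>s\<close> in the event, \<open>s = 1\<close> gives the
    upper tail and \<open>s = -1\<close> the lower one.\<close>
  have markov: "measure_pmf.prob M {\<omega>. s * \<theta> \<le> s * X \<omega>} \<le> exp (\<mu> * (exp s - 1) - s * \<theta>)" for s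
  proof -
    have "measure_pmf.prob M {\<omega> \<in> space (measure_pmf M). exp (s * \<theta>) \<le> exp (s * X \<omega>)}
        \<le> measure_pmf.expectation M (\<lambda>\<omega>. exp (s * X \<omega>)) / exp (s * \<theta>)"
      by (rule integral_Markov_inequality_measure[where A = "{}"])
        (use integrable_exp_card_Pi_bernoulli[where P = P and g = g and p = p, OF assms] in \<open>auto simp: M_def X_def\<close>)
    also have "\<dots> \<le> exp (\<mu> * (exp s - 1)) / exp (s * \<theta>)"
      using expectation_exp_card_Pi_bernoulli_le[where P = P and g = g and p = p, OF assms]
      by (intro divide_right_mono) (auto simp: M_def X_def \<mu>_def)
    finally show ?thesis by (simp add: exp_diff)
  qed
  have "\<mu> * (exp 1 - 1) \<le> \<mu> * 2"
    using \<open>0 \<le> \<mu>\<close> exp_le by (intro mult_left_mono) auto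
  then have "exp (\<mu> * (exp 1 - 1) - 1 * \<theta>) \<le> exp (2 * \<mu> - \<theta>)" by simp
  from order.trans[OF markov[of 1] this] show ?upper
    by (simp add: M_def X_def \<mu>_def)
  have "exp (-1) \<le> (1 / 2 :: real)"
    using exp_ge_add_one_self[of 1] by (simp add: exp_minus field_simps)
  then have "\<mu> * (exp (-1) - 1) \<le> \<mu> * (-1 / 2)"
    using \<open>0 \<le> \<mu>\<close> by (intro mult_left_mono) auto
  then have "exp (\<mu> * (exp (-1) - 1) - (-1) * \<theta>) \<le> exp (\<theta> - \<mu> / 2)" by simp
  from order.trans[OF markov[of "-1"] this] show ?lower
    by (simp add: M_def X_def \<mu>_def)
qed

text \<open>If a random edge has weight \<open>160 / (p * card W)\<close>, these bounds become the
  constants 40 and 1 of \<open>side_lower_bound\<close>. The mean degree into \<open>W\<close> of a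
  vertex of \<open>T\<close> is \<open>p * card W\<close>; that of a vertex of \<open>W\<close> into
  \<open>T\<close> is smaller by the factor \<open>card T / card W\<close>.\<close>

definition typical_degrees :: "real \<Rightarrow> nat set \<Rightarrow> nat set \<Rightarrow> edges \<Rightarrow> bool" where
  "typical_degrees p W T R \<longleftrightarrow>
     (\<forall>t\<in>T. p * real (card W) / 4 \<le> real (card {w \<in> W. {w, t} \<in> R})) \<and>
     (\<forall>w\<in>W. real (card {t \<in> T. {w, t} \<in> R}) \<le> p * real (card W) / 160)"

text \<open>A union bound over all vertices, each of which fails with probability at most
  \<open>exp (- 2 * L)\<close> by one of the two Chernoff bounds.\<close>

lemma prob_atypical_degrees:
  assumes fin: "finite W" "finite T" and disj: "W \<inter> T = {}"
    and I: "finite I" "cross W T \<subseteq> I" and P: "\<And>e. e \<in> cross W T \<Longrightarrow> P e = p"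
    and p: "0 \<le> p" "p \<le> 1" and small: "4000 * card T \<le> card W"
    and large: "400 * L \<le> p * real (card W)" "0 \<le> L"
  shows "measure_pmf.prob (Pi_pmf I False (\<lambda>e. bernoulli_pmf (P e))) {\<omega>. \<not> typical_degrees p W T {e. \<omega> e}}
    \<le> real (card (W \<union> T)) * exp (- 2 * L)"
proof -
  define M where "M = Pi_pmf I False (\<lambda>e. bernoulli_pmf (P e))"
  define \<mu> where "\<mu> = p * real (card W)"
  define bad where "bad u =
    (if u \<in> W then {\<omega>. \<mu> / 160 \<le> real (card {t \<in> T. \<omega> {u, t}})}
     else {\<omega>. real (card {w \<in> W. \<omega> {w, u}}) \<le> \<mu> / 4})" for u
  have "measure_pmf.prob M (bad u) \<le> exp (- 2 * L)" if u: "u \<in> W \<union> T" for u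
  proof (cases "u \<in> W")
    case True
    then have bad: "bad u = {\<omega>. \<mu> / 160 \<le> real (card {t \<in> T. \<omega> {u, t}})}"
      by (simp only: bad_def if_True)
    have "measure_pmf.prob M (bad u) \<le> exp (2 * (p * real (card T)) - \<mu> / 160)"
      unfolding M_def bad using True I P p
      by (intro prob_card_ge_le[where g = "\<lambda>t. {u, t}" and P = P])
        (auto simp: inj_on_def doubleton_eq_iff cross_def)
    \<comment> \<open>By \<open>small\<close> the first term is at most \<open>\<mu> / 2000\<close>,
      so the exponent is at most \<open>- 23 * \<mu> / 4000\<close>, and \<open>\<mu>\<close> is at
      least \<open>400 * L\<close>.\<close>
    also have "2 * (p * real (card T)) - \<mu> / 160 \<le> - 2 * L"
    proof -
      have "p * (4000 * real (card T)) \<le> p * real (card W)"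
        using small p by (intro mult_left_mono) linarith+
      then show ?thesis using large by (simp add: \<mu>_def)
    qed
    finally show ?thesis by simp
  next
    case False
    then have bad: "bad u = {\<omega>. real (card {w \<in> W. \<omega> {w, u}}) \<le> \<mu> / 4}"
      by (simp only: bad_def if_False)
    have "measure_pmf.prob M (bad u) \<le> exp (\<mu> / 4 - p * real (card W) / 2)"
      unfolding M_def bad using False u I P p
      by (intro prob_card_le_le[where g = "\<lambda>w. {w, u}" and P = P])
        (auto simp: inj_on_def doubleton_eq_iff cross_def)
    also have "\<dots> \<le> exp (- 2 * L)"
      using large by (simp add: \<mu>_def)
    finally show ?thesis .
  qed
  then have "(\<Sum>u\<in>W \<union> T. measure_pmf.prob M (bad u)) \<le> real (card (W \<union> T)) * exp (- 2 * L)"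
    by (rule sum_bounded_above)
  moreover have "measure_pmf.prob M (\<Union>u\<in>W \<union> T. bad u) \<le> (\<Sum>u\<in>W \<union> T. measure_pmf.prob M (bad u))"
    using fin by (intro measure_pmf.finite_measure_subadditive_finite) auto
  moreover have "measure_pmf.prob M {\<omega>. \<not> typical_degrees p W T {e. \<omega> e}}
      \<le> measure_pmf.prob M (\<Union>u\<in>W \<union> T. bad u)"
    using disj
    by (intro measure_pmf.finite_measure_mono) (auto simp: typical_degrees_def bad_def \<mu>_def not_le)
  ultimately show ?thesis by (simp add: M_def)
qed

lemma planted_partition_card:
  assumes part: "planted_partition n \<epsilon>1 \<epsilon>2 S T S' T'"
    and \<epsilon>: "\<epsilon>1 \<le> 1 / 10000" "\<epsilon>2 \<le> 1 / 10000"
  shows "finite S" "finite S'" "real (card (S - T)) = real n / 2 - real (card T)"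
    "real (card (S' - T')) = real n / 2 - real (card T')"
    "real (card T) \<le> real n / 10000" "real (card T') \<le> real n / 10000"
proof -
  have "finite (S \<union> S')"
    using part by (simp add: planted_partition_def)
  then show fin: "finite S" "finite S'" by auto
  have "finite T" "finite T'"
    using part fin by (auto simp: planted_partition_def intro: finite_subset)
  moreover have "card T \<le> card S" "card T' \<le> card S'"
    using part fin by (auto simp: planted_partition_def intro!: card_mono)
  ultimately show "real (card (S - T)) = real n / 2 - real (card T)"
    "real (card (S' - T')) = real n / 2 - real (card T')"
    using part by (auto simp: planted_partition_def card_Diff_subset of_nat_diff)
  show "real (card T) \<le> real n / 10000" "real (card T') \<le> real n / 10000"
    using part mult_right_mono[OF \<epsilon>(1), of "real n"] mult_right_mono[OF \<epsilon>(2), of "real n"]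
    by (auto simp: planted_partition_def)
qed

text \<open>With \<open>L = ln n\<close> each vertex fails with probability at most the inverse
  square of \<open>n\<close>; the \<open>n\<close> vertices of the two sides together give
  \<open>1 / n\<close>.\<close>

lemma random_edges_typical:
  assumes part: "planted_partition n \<epsilon>1 \<epsilon>2 S T S' T'" and n: "0 < n"
    and p1: "p1 \<in> {1000 * ln (real n) / real n <.. 1}"
    and p2: "p2 \<in> {1000 * ln (real n) / real n <.. 1}"
    and \<epsilon>: "\<epsilon>1 \<le> 1 / 10000" "\<epsilon>2 \<le> 1 / 10000"
  shows "1 - 1 / real n \<le> measure_pmf.prob (random_edges p1 p2 S T S' T')
    {R. typical_degrees p1 (S - T) T R \<and> typical_degrees p2 (S' - T') T' R}"
proof -
  define I where "I = cross (S - T) T \<union> cross (S' - T') T'"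
  define P where "P e = (if e \<in> cross (S - T) T then p1 else p2)" for e
  define M where "M = Pi_pmf I False (\<lambda>e. bernoulli_pmf (P e))"
  define L where "L = ln (real n)"
  note card = planted_partition_card[OF part \<epsilon>]
  have part': "S \<inter> S' = {}" "T \<subseteq> S" "T' \<subseteq> S'" "S \<union> S' = {..<n}"
    using part by (auto simp: planted_partition_def)
  have finT: "finite T" "finite T'"
    using card part' by (auto intro: finite_subset)
  have "I \<subseteq> Pow (S \<union> S')"
    using part' by (auto simp: I_def cross_def)
  then have I: "finite I"
    using card by (auto intro: finite_subset)
  have "0 \<le> L" using n by (simp add: L_def)
  \<comment> \<open>Hence \<open>P\<close> takes the value \<open>p2\<close> on all pairs of the
    second side, although it tests for the first side.\<close>
  have disj: "cross (S - T) T \<inter> cross (S' - T') T' = {}"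
    using part'(1-3) by (auto simp: cross_def doubleton_eq_iff disjoint_iff subset_iff)
  \<comment> \<open>Each expander contains at least 2/5 of all vertices, and 1000 times 2/5 is
    400.\<close>
  have large: "400 * L \<le> p * real m" and nonneg: "0 \<le> p"
    if "p \<in> {1000 * L / real n <.. 1}" "real m = real n / 2 - k" "k \<le> real n / 10000" for p k m
  proof -
    have "0 \<le> 1000 * L / real n" using \<open>0 \<le> L\<close> by simp
    with that show "0 \<le> p" by auto
    have "400 * L = (1000 * L / real n) * (real n * (2 / 5))" using n by simp
    also have "\<dots> \<le> p * real m"
      using that \<open>0 \<le> p\<close> \<open>0 \<le> L\<close> n by (intro mult_mono) auto
    finally show "400 * L \<le> p * real m" .
  qed
  note large1 = large[OF p1[folded L_def] card(3,5)] nonneg[OF p1[folded L_def] card(3,5)]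
  note large2 = large[OF p2[folded L_def] card(4,6)] nonneg[OF p2[folded L_def] card(4,6)]
  have "measure_pmf.prob M {\<omega>. \<not> typical_degrees p1 (S - T) T {e. \<omega> e}}
      \<le> real (card (S - T \<union> T)) * exp (- 2 * L)"
    unfolding M_def
    by (rule prob_atypical_degrees)
      (use card finT I p1 \<open>0 \<le> L\<close> large1 in \<open>auto simp: I_def P_def\<close>)
  moreover have "measure_pmf.prob M {\<omega>. \<not> typical_degrees p2 (S' - T') T' {e. \<omega> e}}
      \<le> real (card (S' - T' \<union> T')) * exp (- 2 * L)"
    unfolding M_def
    by (rule prob_atypical_degrees)
      (use card finT I p2 \<open>0 \<le> L\<close> large2 disj in \<open>auto simp: I_def P_def\<close>)
  moreover have "S - T \<union> T = S" "S' - T' \<union> T' = S'" using part' by auto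
  moreover have "real n * (1 / (real n)\<^sup>2) = real (card S) * (1 / (real n)\<^sup>2) + real (card S') * (1 / (real n)\<^sup>2)"
    unfolding distrib_right[symmetric] using part by (simp add: planted_partition_def)
  moreover have "exp (- 2 * L) = 1 / (real n)\<^sup>2"
    using n by (simp add: L_def exp_minus exp_double field_simps)
  ultimately have "measure_pmf.prob M {\<omega>. \<not> typical_degrees p1 (S - T) T {e. \<omega> e}}
      + measure_pmf.prob M {\<omega>. \<not> typical_degrees p2 (S' - T') T' {e. \<omega> e}} \<le> real n * (1 / (real n)\<^sup>2)"
    by simp
  also have "real n * (1 / (real n)\<^sup>2) = 1 / real n"
    by (simp add: power2_eq_square)
  finally have "measure_pmf.prob M ({\<omega>. \<not> typical_degrees p1 (S - T) T {e. \<omega> e}}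
      \<union> {\<omega>. \<not> typical_degrees p2 (S' - T') T' {e. \<omega> e}}) \<le> 1 / real n"
    by (intro order.trans[OF measure_subadditive]) auto
  moreover have "measure_pmf.prob M ({\<omega>. \<not> typical_degrees p1 (S - T) T {e. \<omega> e}}
      \<union> {\<omega>. \<not> typical_degrees p2 (S' - T') T' {e. \<omega> e}}) =
    1 - measure_pmf.prob M {\<omega>. typical_degrees p1 (S - T) T {e. \<omega> e} \<and> typical_degrees p2 (S' - T') T' {e. \<omega> e}}"
    by (subst measure_pmf.prob_compl[symmetric]) (auto intro!: arg_cong[where f = "measure_pmf.prob M"])
  ultimately show ?thesis
    by (simp add: random_edges_def M_def I_def P_def vimage_def)
qed

section \<open>The semidefinite program\<close>

lemma pairs_mono:
  assumes "A \<subseteq> B"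
  shows "pairs A \<subseteq> pairs B"
proof -
  have "i \<in> B" if "i \<in> A" for i using assms that by auto
  then show ?thesis unfolding pairs_def by auto
qed

lemma cross_subset_pairs: "A \<subseteq> C \<Longrightarrow> B \<subseteq> C \<Longrightarrow> A \<inter> B = {} \<Longrightarrow> cross A B \<subseteq> pairs C"
proof
  fix e
  assume AB: "A \<subseteq> C" "B \<subseteq> C" "A \<inter> B = {}" and "e \<in> cross A B"
  then obtain i j where "e = {i, j}" "i \<in> A" "j \<in> B"
    by (auto simp: cross_def)
  moreover from this AB have "i \<in> C" "j \<in> C" "i \<noteq> j" by auto
  ultimately show "e \<in> pairs C"
    unfolding pairs_def by blast
qed

section \<open>Dual weights on one expander and its random edges\<close>

locale expander_side =
  fixes W T :: "nat set" and H R :: edges and d :: nat and \<beta> :: real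
  assumes finite_W: "finite W" and finite_T: "finite T" and W_nonempty: "W \<noteq> {}"
    and H_pairs: "H \<subseteq> pairs W" and regular: "\<And>w. w \<in> W \<Longrightarrow> vdegree H w = d" and d_pos: "0 < d"
    and gap: "9 / 10 \<le> spectral_gap W H"
    and \<beta>_nonneg: "0 \<le> \<beta>"
    and deg_T: "\<And>t. t \<in> T \<Longrightarrow> 40 \<le> \<beta> * real (card {w \<in> W. {w, t} \<in> R})"
    and deg_W: "\<And>w. w \<in> W \<Longrightarrow> \<beta> * real (card {t \<in> T. {w, t} \<in> R}) \<le> 1"
begin

text \<open>The part of the dual solution at the vertex \<open>w\<close> of the expander: its weight is split evenly
  between the expander edges and the random edges.\<close>

definition cost :: "(nat \<Rightarrow> nat \<Rightarrow> real) \<Rightarrow> nat \<Rightarrow> real" where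
  "cost D w = (\<Sum>j\<in>nbrs H w. D w j) / d / 2 + \<beta> * (\<Sum>t | t \<in> T \<and> {w, t} \<in> R. D w t) / 2"

definition mean :: "(nat \<Rightarrow> real) \<Rightarrow> real" where
  "mean x = (\<Sum>w\<in>W. x w) / card W"

lemma sum_diff_mean: "(\<Sum>w\<in>W. x w - mean x) = 0"
  using finite_W W_nonempty by (simp add: sum_subtractf mean_def)

lemma cost_sum: "cost (\<lambda>i j. \<Sum>k\<in>A. D k i j) w = (\<Sum>k\<in>A. cost (D k) w)"
proof -
  have "(\<Sum>j\<in>J. \<Sum>k\<in>A. D k w j) = (\<Sum>k\<in>A. \<Sum>j\<in>J. D k w j)" for J
    by (rule sum.swap)
  then show ?thesis
    by (simp add: cost_def sum.distrib sum_divide_distrib sum_distrib_left)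
qed

text \<open>The first half of \<open>cost\<close> is half an average. The weights in the second half
  sum to at most 1/2 and possibly to less, which is where \<open>0 \<le> e\<close> enters.\<close>

lemma cost_le:
  assumes w: "w \<in> W" and e: "0 \<le> e" and D: "\<And>j. {w, j} \<in> H \<union> R \<Longrightarrow> D w j \<le> e"
  shows "cost D w \<le> e"
proof -
  have "(\<Sum>j\<in>nbrs H w. D w j) \<le> real (card (nbrs H w)) * e"
    using D by (intro sum_bounded_above) (auto simp: nbrs_def)
  then have 1: "(\<Sum>j\<in>nbrs H w. D w j) / d \<le> e"
    using regular[OF w] d_pos by (simp add: vdegree_def field_simps)
  have "(\<Sum>t | t \<in> T \<and> {w, t} \<in> R. D w t) \<le> real (card {t \<in> T. {w, t} \<in> R}) * e"
    using D by (intro sum_bounded_above) auto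
  then have "\<beta> * (\<Sum>t | t \<in> T \<and> {w, t} \<in> R. D w t) \<le> \<beta> * (real (card {t \<in> T. {w, t} \<in> R}) * e)"
    using \<beta>_nonneg by (rule mult_left_mono)
  also have "\<dots> \<le> 1 * e"
    unfolding mult.assoc[symmetric] using deg_W[OF w] e by (rule mult_right_mono)
  finally show ?thesis
    using 1 by (simp add: cost_def)
qed

lemma cost_ge:
  "2 / 5 * (\<Sum>w\<in>W. (x w - mean x)\<^sup>2) + 10 * (\<Sum>t\<in>T. (x t - mean x)\<^sup>2)
    \<le> (\<Sum>w\<in>W. cost (\<lambda>i j. (x i - x j)\<^sup>2) w)"
proof -
  have "2 * (9 / 10) * (\<Sum>w\<in>W. (x w - mean x)\<^sup>2) \<le> (\<Sum>w\<in>W. (\<Sum>j\<in>nbrs H w. (x w - x j)\<^sup>2) / d)"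
    by (rule spectral_gap_poincare[OF finite_W H_pairs regular d_pos gap _ sum_diff_mean]) auto
  then have "9 / 5 * (\<Sum>w\<in>W. (x w - mean x)\<^sup>2) \<le> (\<Sum>w\<in>W. (\<Sum>j\<in>nbrs H w. (x w - x j)\<^sup>2) / d)"
    by simp
  from side_lower_bound[OF finite_W finite_T \<beta>_nonneg this deg_T deg_W] show ?thesis
    by (simp add: cost_def sum.distrib sum_divide_distrib[symmetric])
qed

end

section \<open>Consequences of the choice of the constants\<close>

lemma typical_degrees_weights:
  assumes p: "0 < p" and W: "finite W" "W \<noteq> {}" and typical: "typical_degrees p W T R"
  defines "\<beta> \<equiv> 160 / (p * real (card W))"
  shows "0 \<le> \<beta>" "\<And>t. t \<in> T \<Longrightarrow> 40 \<le> \<beta> * real (card {w \<in> W. {w, t} \<in> R})"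
    "\<And>w. w \<in> W \<Longrightarrow> \<beta> * real (card {t \<in> T. {w, t} \<in> R}) \<le> 1"
  using typical p W by (auto simp: typical_degrees_def \<beta>_def field_simps card_gt_0_iff)

lemma roughly_regular_1:
  assumes reg: "roughly_regular W H r" and r: "r \<le> 1" and W: "finite W" "W \<noteq> {}"
  shows "\<exists>d>0. \<forall>w\<in>W. vdegree H w = d"
proof -
  define D where "D = vdegree H ` W"
  have D: "finite D" "D \<noteq> {}" using W by (auto simp: D_def)
  have pos: "0 < Min D" and "real (Max D) / real (Min D) \<le> r"
    using reg by (auto simp: roughly_regular_def D_def)
  then have "real (Max D) / real (Min D) \<le> 1" using r by linarith
  then have "Max D \<le> Min D" using pos by (simp add: divide_le_eq)
  then have "e = Min D" if "e \<in> D" for e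
    using D that by (meson Max_ge Min_le order.antisym order.trans)
  with pos show ?thesis by (auto simp: D_def)
qed

text \<open>For \<open>c = 1\<close> all boundary degrees lie between 1 and 1, so the bipartite
  graph is a perfect matching and \<open>f\<close> maps a vertex to its partner. For
  \<open>c < 1\<close> the boundary is empty and any \<open>f\<close> will do.\<close>

lemma cut_edges_matching:
  assumes cut: "cut_edges c T T' F" and c: "c \<le> 1"
  obtains f where "\<And>t. t \<in> (if c < 1 then {} else T \<union> T') \<Longrightarrow>
    {t, f t} \<in> F \<and> f (f t) = t \<and> (t \<in> T \<and> f t \<in> T' \<or> t \<in> T' \<and> f t \<in> T)"
proof (cases "c < 1")
  case True
  then show thesis using that[of id] by simp
next
  case False
  with c cut have F: "F \<subseteq> cross T T'"
    and deg: "\<And>t. t \<in> T \<union> T' \<Longrightarrow> card (nbrs F t) = 1"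
    by (force simp: cut_edges_def vdegree_def)+
  define f where "f t = the_elem (nbrs F t)" for t
  have f: "nbrs F t = {f t}" if t: "t \<in> T \<union> T'" for t
  proof -
    obtain u where "nbrs F t = {u}" using deg[OF t] by (rule card_1_singletonE)
    then show ?thesis by (simp add: f_def)
  qed
  have "{t, f t} \<in> F \<and> f (f t) = t \<and> (t \<in> T \<and> f t \<in> T' \<or> t \<in> T' \<and> f t \<in> T)"
    if t: "t \<in> T \<union> T'" for t
  proof -
    have "f t \<in> nbrs F t" using f[OF t] by simp
    then have edge: "{t, f t} \<in> F" by (simp add: nbrs_def)
    then have side: "t \<in> T \<and> f t \<in> T' \<or> t \<in> T' \<and> f t \<in> T"
      using F by (auto simp: cross_def doubleton_eq_iff)
    then have "f t \<in> T \<union> T'" by auto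
    then have "nbrs F (f t) = {f (f t)}" by (rule f)
    moreover have "t \<in> nbrs F (f t)"
      using edge by (simp add: nbrs_def insert_commute)
    ultimately show ?thesis using edge side by auto
  qed
  then show thesis using that[of f] False by simp
qed

section \<open>Weak duality and the unique optimum for a fixed graph\<close>

locale planted_graph =
  side: expander_side "S - T" T H R d \<beta> + side': expander_side "S' - T'" T' H' R d' \<beta>'
  for S T S' T' H H' R d d' \<beta> \<beta>' +
  fixes n :: nat and G :: edges and B :: "nat set" and f :: "nat \<Rightarrow> nat"
  assumes union: "S \<union> S' = {..<n}" and disj: "S \<inter> S' = {}"
    and sub: "T \<subseteq> S" "T' \<subseteq> S'"
    and balanced: "card S = card S'" and small: "5 * (card T + card T') \<le> card S"
    and G_edges: "H \<union> H' \<union> R \<subseteq> G" "G \<subseteq> pairs {..<n}"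
    and G_cross: "\<And>i j. {i, j} \<in> G \<Longrightarrow> i \<in> S \<Longrightarrow> j \<in> S' \<Longrightarrow> i \<in> B \<and> j \<in> B"
    and f: "\<And>t. t \<in> B \<Longrightarrow> {t, f t} \<in> G" "\<And>t. t \<in> B \<Longrightarrow> f t \<in> B" "\<And>t. t \<in> B \<Longrightarrow> f (f t) = t"
      "\<And>t. t \<in> B \<Longrightarrow> t \<in> T \<and> f t \<in> T' \<or> t \<in> T' \<and> f t \<in> T"
begin

lemma finite_S: "finite S" "finite S'"
  using finite_lessThan[of n] unfolding union[symmetric] by simp_all

lemma card_S_pos: "0 < card S"
  using finite_S side.W_nonempty by (auto simp: card_gt_0_iff)

lemma n_pos: "0 < n"
  using union side.W_nonempty by auto

lemma B_subset: "B \<subseteq> T \<union> T'" "B \<subseteq> {..<n}"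
  using f(4) sub union by auto

lemma sum_vertices:
  fixes g :: "nat \<Rightarrow> real"
  shows "(\<Sum>i<n. g i) = (\<Sum>i\<in>S - T. g i) + (\<Sum>i\<in>S' - T'. g i) + (\<Sum>i\<in>T \<union> T'. g i)"
proof -
  have "(\<Sum>i<n. g i) = (\<Sum>i\<in>S. g i) + (\<Sum>i\<in>S'. g i)"
    using union disj finite_S by (metis sum.union_disjoint)
  moreover have "(\<Sum>i\<in>S. g i) = (\<Sum>i\<in>S - T. g i) + (\<Sum>i\<in>T. g i)"
    "(\<Sum>i\<in>S'. g i) = (\<Sum>i\<in>S' - T'. g i) + (\<Sum>i\<in>T'. g i)"
    using finite_S sub by (intro sum.subset_diff; auto)+
  moreover have "(\<Sum>i\<in>T \<union> T'. g i) = (\<Sum>i\<in>T. g i) + (\<Sum>i\<in>T'. g i)"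
    using side.finite_T side'.finite_T sub disj by (intro sum.union_disjoint) auto
  ultimately show ?thesis by simp
qed

lemma nbrs_G: "nbrs G i \<subseteq> {..<n}" "finite (nbrs G i)"
proof -
  show *: "nbrs G i \<subseteq> {..<n}"
    using G_edges(2) by (auto simp: nbrs_def pairs_def doubleton_eq_iff)
  show "finite (nbrs G i)" by (rule finite_subset[OF *]) simp
qed

text \<open>Expander vertices have positive degree in \<open>H\<close> or \<open>H'\<close>, and
  vertices of \<open>T\<close> and \<open>T'\<close> have a random edge. This makes the maximum in
  \<open>planted_eta\<close> meaningful and forces every feasible \<open>\<eta>\<close> to be
  nonnegative.\<close>

lemma nbrs_G_nonempty:
  assumes "i < n"
  shows "nbrs G i \<noteq> {}"
proof -
  have expander: "nbrs G i \<noteq> {}" if "vdegree K i = k" "0 < k" "K \<subseteq> G" for K k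
  proof -
    have "nbrs K i \<noteq> {}" using that by (auto simp: vdegree_def)
    then show ?thesis using that by (auto simp: nbrs_def)
  qed
  have boundary: "nbrs G i \<noteq> {}" if "40 \<le> b * real (card {w \<in> W. {w, i} \<in> R})" for b W
  proof -
    have "{w \<in> W. {w, i} \<in> R} \<noteq> {}"
    proof
      assume "{w \<in> W. {w, i} \<in> R} = {}"
      then show False using that by (simp only: card.empty)
    qed
    then obtain w where "{i, w} \<in> R" by (auto simp: insert_commute)
    then show ?thesis using G_edges(1) by (auto simp: nbrs_def)
  qed
  have "i \<in> S \<union> S'" using assms union by simp
  then consider "i \<in> S - T" | "i \<in> T" | "i \<in> S' - T'" | "i \<in> T'" by blast
  then show ?thesis
  proof cases
    case 1
    then show ?thesis using side.regular side.d_pos G_edges(1) by (intro expander) auto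
  next
    case 2
    show ?thesis by (rule boundary[OF side.deg_T[OF 2]])
  next
    case 3
    then show ?thesis using side'.regular side'.d_pos G_edges(1) by (intro expander) auto
  next
    case 4
    show ?thesis by (rule boundary[OF side'.deg_T[OF 4]])
  qed
qed

definition deviation :: "(nat \<Rightarrow> real) \<Rightarrow> real" where
  "deviation x = (\<Sum>i\<in>S. (x i - side.mean x)\<^sup>2) + (\<Sum>i\<in>S'. (x i - side'.mean x)\<^sup>2)"

text \<open>The dual objective: each vertex spends a total weight of at most 1 on the differences
  along its edges. Boundary vertices spend all of it on their matching edge; a vertex of
  \<open>T\<close> or \<open>T'\<close> outside \<open>B\<close> spends nothing.\<close>

definition total_cost :: "(nat \<Rightarrow> nat \<Rightarrow> real) \<Rightarrow> real" where
  "total_cost D = (\<Sum>t\<in>B. D t (f t)) + (\<Sum>w\<in>S - T. side.cost D w) + (\<Sum>w\<in>S' - T'. side'.cost D w)"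

lemma total_cost_ge:
  assumes sum0: "(\<Sum>i<n. x i) = 0"
  shows "4 * (\<Sum>t\<in>B. (x t)\<^sup>2) + 2 / 5 * deviation x \<le> total_cost (\<lambda>i j. (x i - x j)\<^sup>2)"
proof -
  have "4 * (\<Sum>t\<in>B. (x t)\<^sup>2) \<le> (\<Sum>t\<in>B. (x t - x (f t))\<^sup>2)
     + 9 * ((\<Sum>t\<in>T. (x t - side.mean x)\<^sup>2) + (\<Sum>t\<in>T'. (x t - side'.mean x)\<^sup>2))"
    using sum0 union
    by (intro boundary_lower_bound[OF finite_S sub disj balanced card_S_pos small f(2-4)]
        side.sum_diff_mean side'.sum_diff_mean) auto
  moreover have "(\<Sum>i\<in>S. (x i - side.mean x)\<^sup>2) =
      (\<Sum>i\<in>S - T. (x i - side.mean x)\<^sup>2) + (\<Sum>i\<in>T. (x i - side.mean x)\<^sup>2)"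
    using finite_S sub by (intro sum.subset_diff) auto
  moreover have "(\<Sum>i\<in>S'. (x i - side'.mean x)\<^sup>2) =
      (\<Sum>i\<in>S' - T'. (x i - side'.mean x)\<^sup>2) + (\<Sum>i\<in>T'. (x i - side'.mean x)\<^sup>2)"
    using finite_S sub by (intro sum.subset_diff) auto
  moreover have "0 \<le> (\<Sum>i\<in>T. (x i - side.mean x)\<^sup>2)" "0 \<le> (\<Sum>i\<in>T'. (x i - side'.mean x)\<^sup>2)"
    by (auto intro: sum_nonneg)
  moreover note side.cost_ge[of x] side'.cost_ge[of x]
  \<comment> \<open>The random edges gain 10 times the squared deviations on \<open>T\<close> and
    \<open>T'\<close>, and the matching loses at most 9 times these; the remaining 1 exceeds
    2/5.\<close>
  moreover have "4 * b + 2 / 5 * (s + s') \<le> e + c + c'"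
    if "4 * b \<le> e + 9 * (t + t')" "s = w + t" "s' = w' + t'" "0 \<le> t" "0 \<le> t'"
      "2 / 5 * w + 10 * t \<le> c" "2 / 5 * w' + 10 * t' \<le> c'" for b e s s' t t' w w' c c' :: real
    using that by argo
  ultimately show ?thesis
    unfolding total_cost_def deviation_def by blast
qed

lemma total_cost_sum: "total_cost (\<lambda>i j. \<Sum>k\<in>A. D k i j) = (\<Sum>k\<in>A. total_cost (D k))"
proof -
  have "(\<Sum>t\<in>X. \<Sum>k\<in>A. g k t) = (\<Sum>k\<in>A. \<Sum>t\<in>X. g k t)" for X and g :: "'a \<Rightarrow> nat \<Rightarrow> real"
    by (rule sum.swap)
  then show ?thesis
    by (simp add: total_cost_def side.cost_sum side'.cost_sum sum.distrib)
qed

text \<open>Weak duality: the weights at each vertex sum to at most 1 and use edges of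
  \<open>G\<close> only, so the cost there is at most its bound \<open>e i\<close>.\<close>

lemma total_cost_le:
  assumes D: "\<And>i j. i < n \<Longrightarrow> j \<in> nbrs G i \<Longrightarrow> 0 \<le> D i j \<and> D i j \<le> e i"
  shows "total_cost D \<le> (\<Sum>i<n. e i)"
proof -
  have e: "0 \<le> e i" if "i < n" for i
    using nbrs_G_nonempty[OF that] D[OF that] by force
  have "(\<Sum>t\<in>B. D t (f t)) \<le> (\<Sum>t\<in>B. e t)"
  proof (rule sum_mono)
    fix t assume "t \<in> B"
    then have "t < n" "f t \<in> nbrs G t"
      using B_subset f(1) by (auto simp: nbrs_def)
    then show "D t (f t) \<le> e t" using D by blast
  qed
  also have "\<dots> \<le> (\<Sum>t\<in>T \<union> T'. e t)"
    using B_subset side.finite_T side'.finite_T sub union by (intro sum_mono2) (auto intro!: e)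
  finally have 1: "(\<Sum>t\<in>B. D t (f t)) \<le> (\<Sum>t\<in>T \<union> T'. e t)" .
  have lt: "w < n" if "w \<in> S \<union> S'" for w using that union by auto
  have 2: "(\<Sum>w\<in>S - T. side.cost D w) \<le> (\<Sum>w\<in>S - T. e w)"
  proof (intro sum_mono side.cost_le)
    fix w assume w: "w \<in> S - T"
    then show "0 \<le> e w" by (intro e lt) auto
    show "D w j \<le> e w" if "{w, j} \<in> H \<union> R" for j
      using that w G_edges(1) lt[of w] D[of w j] by (auto simp: nbrs_def)
  qed
  have 3: "(\<Sum>w\<in>S' - T'. side'.cost D w) \<le> (\<Sum>w\<in>S' - T'. e w)"
  proof (intro sum_mono side'.cost_le)
    fix w assume w: "w \<in> S' - T'"
    then show "0 \<le> e w" by (intro e lt) auto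
    show "D w j \<le> e w" if "{w, j} \<in> H' \<union> R" for j
      using that w G_edges(1) lt[of w] D[of w j] by (auto simp: nbrs_def)
  qed
  show ?thesis
    using 1 2 3 unfolding total_cost_def sum_vertices by simp
qed

text \<open>Zero deviation makes \<open>x\<close> constant on each side. As the sides have equal
  size and \<open>x\<close> sums to 0, the two constants are opposite.\<close>

lemma deviation_0_imp:
  assumes dev: "deviation x = 0" and sum0: "(\<Sum>i<n. x i) = 0" and i: "i < n"
  shows "x i = side.mean x * sign_vec S i"
proof -
  have "(\<Sum>i\<in>S. (x i - side.mean x)\<^sup>2) = 0" "(\<Sum>i\<in>S'. (x i - side'.mean x)\<^sup>2) = 0"
    using dev unfolding deviation_def by (simp_all add: add_nonneg_eq_0_iff sum_nonneg)
  then have "\<forall>i\<in>S. x i = side.mean x" "\<forall>i\<in>S'. x i = side'.mean x"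
    using finite_S by (simp_all add: sum_nonneg_eq_0_iff)
  then have S: "\<And>i. i \<in> S \<Longrightarrow> x i = side.mean x" and S': "\<And>i. i \<in> S' \<Longrightarrow> x i = side'.mean x"
    by blast+
  have "(\<Sum>i<n. x i) = (\<Sum>i\<in>S. x i) + (\<Sum>i\<in>S'. x i)"
    using union disj finite_S by (metis sum.union_disjoint)
  also have "(\<Sum>i\<in>S. x i) = card S * side.mean x"
    using sum.cong[OF refl S, of S] by simp
  also have "(\<Sum>i\<in>S'. x i) = card S * side'.mean x"
    using sum.cong[OF refl S', of S'] balanced by simp
  finally have "real (card S) * (side.mean x + side'.mean x) = 0"
    using sum0 by (simp add: distrib_left)
  then have "side'.mean x = - side.mean x"
    using card_S_pos by simp
  moreover have "i \<in> S \<or> i \<in> S'" using i union by auto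
  ultimately show ?thesis
    using S S' disj by (auto simp: sign_vec_def)
qed

text \<open>\<open>total_cost_ge\<close> is summed over the Gram vectors of \<open>U\<close>. The
  deviations are the slack in the resulting bound, so equality makes every Gram vector a multiple of
  the sign vector.\<close>

lemma feasible_bound:
  assumes feas: "sdp_feasible n G U \<eta>"
  shows "4 * real (card B) \<le> (\<Sum>i<n. \<eta> $ i)"
    and "(\<Sum>i<n. \<eta> $ i) \<le> 4 * real (card B) \<Longrightarrow> U = planted_U n S"
proof -
  have carr: "U \<in> carrier_mat n n" and trans: "transpose_mat U = U"
    and \<eta>: "\<And>i j. i < n \<Longrightarrow> j \<in> nbrs G i \<Longrightarrow> U $$ (i, i) + U $$ (j, j) - 2 * U $$ (i, j) \<le> \<eta> $ i"
    and diag: "\<And>i. i < n \<Longrightarrow> U $$ (i, i) = 1"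
    and sum0: "(\<Sum>i<n. \<Sum>j<n. U $$ (i, j)) = 0" and psd: "psd n U"
    using feas by (auto simp: sdp_feasible_def)
  have "\<exists>X. \<forall>i<n. \<forall>j<n. U $$ (i, j) = (\<Sum>k<n. X k i * X k j)"
  proof (rule psd_gram)
    fix i j assume "i < n" "j < n"
    then have "transpose_mat U $$ (j, i) = U $$ (i, j)" using carr by simp
    then show "U $$ (i, j) = U $$ (j, i)" by (simp add: trans)
  next
    fix x
    have "0 \<le> Matrix.vec n x \<bullet> (U *\<^sub>v Matrix.vec n x)"
      using psd by (simp add: psd_def)
    also have "\<dots> = (\<Sum>i<n. \<Sum>j<n. x i * x j * U $$ (i, j))"
      using carr by (simp add: scalar_prod_def atLeast0LessThan sum_distrib_left ac_simps)
    finally show "0 \<le> (\<Sum>i<n. \<Sum>j<n. x i * x j * U $$ (i, j))" .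
  qed
  then obtain X where X: "\<And>i j. i < n \<Longrightarrow> j < n \<Longrightarrow> U $$ (i, j) = (\<Sum>k<n. X k i * X k j)"
    by blast
  \<comment> \<open>The entries of \<open>U\<close> add up to a sum of squares, so the balance
    constraint makes every single Gram vector sum to 0.\<close>
  have "(\<Sum>k<n. (\<Sum>i<n. X k i)\<^sup>2) = (\<Sum>k<n. \<Sum>i<n. \<Sum>j<n. X k i * X k j)"
    by (simp add: power2_eq_square sum_product)
  also have "\<dots> = (\<Sum>i<n. \<Sum>k<n. \<Sum>j<n. X k i * X k j)"
    by (rule sum.swap)
  also have "\<dots> = (\<Sum>i<n. \<Sum>j<n. \<Sum>k<n. X k i * X k j)"
    by (intro sum.cong refl sum.swap)
  also have "\<dots> = 0"
    using sum0 X by simp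
  finally have X0: "(\<Sum>i<n. X k i) = 0" if "k < n" for k
    using that by (simp add: sum_nonneg_eq_0_iff)
  define D where "D i j = (\<Sum>k<n. (X k i - X k j)\<^sup>2)" for i j
  have D: "D i j = U $$ (i, i) + U $$ (j, j) - 2 * U $$ (i, j)" if "i < n" "j < n" for i j
  proof -
    have "(X k i - X k j)\<^sup>2 = X k i * X k i + X k j * X k j - 2 * (X k i * X k j)" for k
      by (simp add: power2_eq_square algebra_simps)
    then show ?thesis
      using X[OF that] X[OF that(1) that(1)] X[OF that(2) that(2)]
      by (simp add: D_def sum.distrib sum_subtractf sum_distrib_left)
  qed
  have "(\<Sum>k<n. 4 * (\<Sum>t\<in>B. (X k t)\<^sup>2) + 2 / 5 * deviation (X k)) \<le>
      (\<Sum>k<n. total_cost (\<lambda>i j. (X k i - X k j)\<^sup>2))"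
    using X0 by (intro sum_mono total_cost_ge) auto
  also have "\<dots> = total_cost D"
    unfolding D_def total_cost_sum ..
  also have "\<dots> \<le> (\<Sum>i<n. \<eta> $ i)"
  proof (rule total_cost_le)
    fix i j assume ij: "i < n" "j \<in> nbrs G i"
    then have "j < n" using nbrs_G by auto
    with ij have "D i j \<le> \<eta> $ i"
      using \<eta>[OF ij] D[of i j] by simp
    then show "0 \<le> D i j \<and> D i j \<le> \<eta> $ i"
      by (simp add: D_def sum_nonneg)
  qed
  finally have "4 * (\<Sum>k<n. \<Sum>t\<in>B. (X k t)\<^sup>2) + 2 / 5 * (\<Sum>k<n. deviation (X k)) \<le> (\<Sum>i<n. \<eta> $ i)"
    by (simp add: sum.distrib sum_distrib_left)
  \<comment> \<open>The unit diagonal turns the boundary term into a number independent of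
    \<open>U\<close>.\<close>
  moreover have "(\<Sum>k<n. \<Sum>t\<in>B. (X k t)\<^sup>2) = (\<Sum>t\<in>B. U $$ (t, t))"
    using B_subset X by (subst sum.swap) (auto simp: power2_eq_square intro!: sum.cong)
  moreover have "(\<Sum>t\<in>B. U $$ (t, t)) = real (card B)"
    using B_subset diag by (subst sum.cong[OF refl, of _ _ "\<lambda>_. 1"]) auto
  ultimately have bound: "4 * real (card B) + 2 / 5 * (\<Sum>k<n. deviation (X k)) \<le> (\<Sum>i<n. \<eta> $ i)"
    by simp
  have dev: "0 \<le> deviation (X k)" for k
    unfolding deviation_def by (intro add_nonneg_nonneg sum_nonneg) auto
  then have dev': "0 \<le> (\<Sum>k<n. deviation (X k))" by (simp add: sum_nonneg)
  with bound show "4 * real (card B) \<le> (\<Sum>i<n. \<eta> $ i)" by simp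
  assume "(\<Sum>i<n. \<eta> $ i) \<le> 4 * real (card B)"
  with bound dev' have "(\<Sum>k<n. deviation (X k)) = 0" by simp
  then have "deviation (X k) = 0" if "k < n" for k
    using that dev by (simp add: sum_nonneg_eq_0_iff)
  then have X_eq: "X k i = side.mean (X k) * sign_vec S i" if "k < n" "i < n" for k i
    using that X0 by (intro deviation_0_imp) auto
  define c where "c = (\<Sum>k<n. (side.mean (X k))\<^sup>2)"
  have U: "U $$ (i, j) = c * (sign_vec S i * sign_vec S j)" if "i < n" "j < n" for i j
  proof -
    have "X k i * X k j = (side.mean (X k))\<^sup>2 * (sign_vec S i * sign_vec S j)" if "k < n" for k
      using X_eq[OF that \<open>i < n\<close>] X_eq[OF that \<open>j < n\<close>] by (simp add: power2_eq_square)
    then show ?thesis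
      unfolding X[OF that] c_def sum_distrib_right by (intro sum.cong) auto
  qed
  have "c = 1"
    using U[OF n_pos n_pos] diag[OF n_pos] by (simp add: sign_vec_def split: if_splits)
  with U carr show "U = planted_U n S"
    by (intro eq_matI) (auto simp: planted_U_def)
qed

lemma sign_vec_diff: "(sign_vec S i - sign_vec S j)\<^sup>2 = (if i \<in> S \<longleftrightarrow> j \<in> S then 0 else 4)"
  by (simp add: sign_vec_def)

lemma planted_eta_nth:
  assumes i: "i < n"
  shows "planted_eta n G S $ i = (if i \<in> B then 4 else 0)"
proof -
  let ?A = "(\<lambda>j. (sign_vec S i - sign_vec S j)\<^sup>2) ` nbrs G i"
  have "Max ?A = (if i \<in> B then 4 else 0)"
  proof (cases "i \<in> B")
    case True
    then have "f i \<in> nbrs G i" "(i \<in> S) \<noteq> (f i \<in> S)"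
      using f(1,4)[of i] sub disj by (auto simp: nbrs_def)
    then show ?thesis
      using True nbrs_G by (intro Max_eqI) (auto simp: sign_vec_diff intro!: rev_image_eqI[of "f i"])
  next
    case False
    have "(i \<in> S) = (j \<in> S)" if j: "j \<in> nbrs G i" for j
    proof (rule ccontr)
      have edge: "{i, j} \<in> G" "{j, i} \<in> G" using j by (auto simp: nbrs_def insert_commute)
      have "j < n" using j nbrs_G by auto
      then have "i \<in> S \<union> S'" "j \<in> S \<union> S'" using i union by auto
      moreover assume "(i \<in> S) \<noteq> (j \<in> S)"
      ultimately show False using G_cross edge False by blast
    qed
    then have "?A = (\<lambda>_. 0) ` nbrs G i"
      by (intro image_cong) (auto simp: sign_vec_diff)
    then show ?thesis
      using False nbrs_G_nonempty[OF i] by (simp add: image_constant_conv)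
  qed
  then show ?thesis using i by (simp add: planted_eta_def)
qed

lemma sum_planted_eta: "(\<Sum>i<n. planted_eta n G S $ i) = 4 * real (card B)"
proof -
  have "(\<Sum>i<n. planted_eta n G S $ i) = (\<Sum>i<n. if i \<in> B then 4 else 0)"
    by (intro sum.cong) (auto simp: planted_eta_nth)
  also have "\<dots> = (\<Sum>i\<in>B. 4)"
    using B_subset by (intro sum.mono_neutral_cong_right) auto
  finally show ?thesis by simp
qed

lemma planted_feasible: "sdp_feasible n G (planted_U n S) (planted_eta n G S)"
  unfolding sdp_feasible_def
proof (intro conjI allI ballI impI)
  show "transpose_mat (planted_U n S) = planted_U n S"
    by (intro eq_matI) (auto simp: planted_U_def)
  show "planted_U n S $$ (i, i) + planted_U n S $$ (j, j) - 2 * planted_U n S $$ (i, j) \<le> planted_eta n G S $ i"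
    if "i < n" "j \<in> nbrs G i" for i j
  proof -
    have "j < n" using that nbrs_G by auto
    then have "planted_U n S $$ (i, i) + planted_U n S $$ (j, j) - 2 * planted_U n S $$ (i, j) =
        (sign_vec S i - sign_vec S j)\<^sup>2"
      using that by (simp add: planted_U_def power2_eq_square algebra_simps)
    also have "\<dots> \<le> planted_eta n G S $ i"
      using that nbrs_G by (auto simp: planted_eta_def)
    finally show ?thesis .
  qed
  have "(\<Sum>i<n. sign_vec S i) = (\<Sum>i\<in>S. sign_vec S i) + (\<Sum>i\<in>S'. sign_vec S i)"
    using union disj finite_S by (metis sum.union_disjoint)
  also have "(\<Sum>i\<in>S'. sign_vec S i) = (\<Sum>i\<in>S'. -1)"
    using disj by (intro sum.cong) (auto simp: sign_vec_def)
  finally have "(\<Sum>i<n. sign_vec S i) = 0"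
    using balanced by (simp add: sign_vec_def)
  then show "(\<Sum>i<n. \<Sum>j<n. planted_U n S $$ (i, j)) = 0"
    by (simp add: planted_U_def sum_product[symmetric])
  show "psd n (planted_U n S)"
    unfolding psd_def
  proof
    fix x :: "real Matrix.vec" assume x: "x \<in> carrier_vec n"
    then have "x \<bullet> (planted_U n S *\<^sub>v x) = (\<Sum>i<n. \<Sum>j<n. (x $ i * sign_vec S i) * (x $ j * sign_vec S j))"
      by (simp add: planted_U_def scalar_prod_def atLeast0LessThan sum_distrib_left ac_simps)
    also have "\<dots> = (\<Sum>i<n. x $ i * sign_vec S i)\<^sup>2"
      by (simp add: power2_eq_square sum_product)
    finally show "0 \<le> x \<bullet> (planted_U n S *\<^sub>v x)" by simp
  qed
qed (auto simp: planted_U_def planted_eta_def sign_vec_def)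

text \<open>The planted pair attains the bound \<open>4 * card B\<close>, and equality determines
  \<open>U\<close>. The edge constraints of the planted matrix then bound \<open>\<eta>\<close> from
  below by \<open>planted_eta\<close> in each entry, and equal sums force equality.\<close>

lemma unique_optimum: "{(U, \<eta>). sdp_optimal n G U \<eta>} = {(planted_U n S, planted_eta n G S)}"
proof -
  have opt: "sdp_optimal n G (planted_U n S) (planted_eta n G S)"
    using planted_feasible feasible_bound(1) by (auto simp: sdp_optimal_def sum_planted_eta)
  have uniq: "U = planted_U n S \<and> \<eta> = planted_eta n G S" if opt: "sdp_optimal n G U \<eta>" for U \<eta>
  proof -
    have feas: "sdp_feasible n G U \<eta>" and le: "(\<Sum>i<n. \<eta> $ i) \<le> 4 * real (card B)"
      using opt planted_feasible by (auto simp: sdp_optimal_def sum_planted_eta[symmetric])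
    have U: "U = planted_U n S"
      using feasible_bound(2)[OF feas le] .
    have ge: "planted_eta n G S $ i \<le> \<eta> $ i" if i: "i < n" for i
    proof -
      have "(sign_vec S i - sign_vec S j)\<^sup>2 \<le> \<eta> $ i" if j: "j \<in> nbrs G i" for j
      proof -
        have "j < n" using j nbrs_G by auto
        have "U $$ (i, i) + U $$ (j, j) - 2 * U $$ (i, j) \<le> \<eta> $ i"
          using feas i j by (auto simp: sdp_feasible_def)
        then show ?thesis
          using i \<open>j < n\<close> by (simp add: U planted_U_def power2_eq_square algebra_simps)
      qed
      then show ?thesis
        using i nbrs_G nbrs_G_nonempty[OF i] by (auto simp: planted_eta_def)
    qed
    have "planted_eta n G S $ i = \<eta> $ i" if "i < n" for i
      using sum_mono_inv[of "\<lambda>i. planted_eta n G S $ i" "{..<n}" "\<lambda>i. \<eta> $ i" i]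
        feasible_bound(1)[OF feas] le ge that by (auto simp: sum_planted_eta)
    moreover have "\<eta> \<in> carrier_vec n" using feas by (simp add: sdp_feasible_def)
    ultimately have "\<eta> = planted_eta n G S"
      by (intro eq_vecI) (auto simp: planted_eta_def)
    with U show ?thesis by simp
  qed
  have iff: "z \<in> {(U, \<eta>). sdp_optimal n G U \<eta>} \<longleftrightarrow> z = (planted_U n S, planted_eta n G S)" for z
  proof (cases z)
    case (Pair U \<eta>)
    show ?thesis unfolding Pair using opt uniq[of U \<eta>] by blast
  qed
  show ?thesis unfolding set_eq_iff singleton_iff using iff by blast
qed

end

section \<open>From the random model to a fixed graph\<close>

lemma completion_unique_optimum:
  assumes part: "planted_partition n \<epsilon>1 \<epsilon>2 S T S' T'" and n: "0 < n"
    and \<epsilon>: "\<epsilon>1 \<le> 1 / 10000" "\<epsilon>2 \<le> 1 / 10000" and p: "0 < p1" "0 < p2"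
    and compl: "completion c r l1 l2 S T S' T' R G"
    and R: "R \<subseteq> cross (S - T) T \<union> cross (S' - T') T'"
    and typical: "typical_degrees p1 (S - T) T R" "typical_degrees p2 (S' - T') T' R"
    and const: "c \<le> 1" "r \<le> 1" "9 / 10 \<le> l1" "9 / 10 \<le> l2"
  shows "{(U, \<eta>). sdp_optimal n G U \<eta>} = {(planted_U n S, planted_eta n G S)}"
proof -
  note card = planted_partition_card[OF part \<epsilon>]
  have union: "S \<union> S' = {..<n}" and disj: "S \<inter> S' = {}" and sub: "T \<subseteq> S" "T' \<subseteq> S'"
    and cards: "real (card S) = real n / 2" "real (card S') = real n / 2"
    using part by (auto simp: planted_partition_def)
  have finT: "finite T" "finite T'"
    using card sub by (auto intro: finite_subset)
  have "0 < card (S - T)" "0 < card (S' - T')"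
    using card n by linarith+
  then have W: "finite (S - T)" "S - T \<noteq> {}" "finite (S' - T')" "S' - T' \<noteq> {}"
    unfolding card_gt_0_iff by simp_all
  obtain H H' F M where
    H: "H \<subseteq> pairs (S - T)" "roughly_regular (S - T) H r" "l1 \<le> spectral_gap (S - T) H" and
    H': "H' \<subseteq> pairs (S' - T')" "roughly_regular (S' - T') H' r" "l2 \<le> spectral_gap (S' - T') H'" and
    F: "cut_edges c T T' F" and M: "M \<subseteq> monotone_pairs c S T S' T'" and G: "G = R \<union> H \<union> H' \<union> F \<union> M"
    using compl by (auto simp: completion_def)
  obtain d where d: "0 < d" "\<And>w. w \<in> S - T \<Longrightarrow> vdegree H w = d"
    using roughly_regular_1[OF H(2) const(2) W(1,2)] by auto
  obtain d' where d': "0 < d'" "\<And>w. w \<in> S' - T' \<Longrightarrow> vdegree H' w = d'"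
    using roughly_regular_1[OF H'(2) const(2) W(3,4)] by auto
  define B where "B = (if c < 1 then {} else T \<union> T')"
  obtain f where f: "\<And>t. t \<in> B \<Longrightarrow>
      {t, f t} \<in> F \<and> f (f t) = t \<and> (t \<in> T \<and> f t \<in> T' \<or> t \<in> T' \<and> f t \<in> T)"
    using cut_edges_matching[OF F const(1)] unfolding B_def by metis
  have F_sub: "F \<subseteq> (if c < 1 then {} else cross T T')"
    using F by (auto simp: cut_edges_def split: if_splits)
  \<comment> \<open>Edges across the planted cut arise only between \<open>T\<close> and
    \<open>T'\<close>, and only if \<open>c\<close> is at least 1. So no addition by the adversary
    enlarges the boundary \<open>B\<close>.\<close>
  have inside: "G \<subseteq> pairs S \<union> pairs S' \<union> (if c < 1 then {} else cross T T')"
  proof -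
    have "R \<subseteq> pairs S \<union> pairs S'"
      using R cross_subset_pairs[of "S - T" S T] cross_subset_pairs[of "S' - T'" S' T'] sub by blast
    moreover have "H \<subseteq> pairs S" "H' \<subseteq> pairs S'"
      using H(1) H'(1) pairs_mono[of "S - T" S] pairs_mono[of "S' - T'" S'] by auto
    ultimately show ?thesis
      using F_sub M unfolding G monotone_pairs_def by blast
  qed
  have "expander_side (S - T) T H R d (160 / (p1 * real (card (S - T))))"
    using W(1) finT(1) W(2) H(1) d(2,1) order.trans[OF const(3) H(3)]
      typical_degrees_weights[OF p(1) W(1,2) typical(1)]
    by (rule expander_side.intro)
  moreover have "expander_side (S' - T') T' H' R d' (160 / (p2 * real (card (S' - T'))))"
    using W(3) finT(2) W(4) H'(1) d'(2,1) order.trans[OF const(4) H'(3)]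
      typical_degrees_weights[OF p(2) W(3,4) typical(2)]
    by (rule expander_side.intro)
  moreover have "planted_graph_axioms S T S' T' H H' R n G B f"
  proof
    show "5 * (card T + card T') \<le> card S"
    proof -
      have "real (5 * (card T + card T')) \<le> real (card S)"
        using card cards by simp
      then show ?thesis by linarith
    qed
    show "card S = card S'" using cards by simp
    show "H \<union> H' \<union> R \<subseteq> G" by (auto simp: G)
    show "G \<subseteq> pairs {..<n}"
    proof -
      have "pairs S \<union> pairs S' \<union> cross T T' \<subseteq> pairs (S \<union> S')"
        using sub disj by (intro Un_least pairs_mono cross_subset_pairs) auto
      then show ?thesis using inside union by (auto split: if_splits)
    qed
    show "i \<in> B \<and> j \<in> B" if "{i, j} \<in> G" "i \<in> S" "j \<in> S'" for i j
    proof -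
      have "{i, j} \<notin> pairs S \<union> pairs S'"
        using that disj by (auto simp: pairs_def doubleton_eq_iff)
      with inside that show ?thesis
        by (auto simp: B_def cross_def doubleton_eq_iff split: if_splits)
    qed
    show "{t, f t} \<in> G" "f (f t) = t" "t \<in> T \<and> f t \<in> T' \<or> t \<in> T' \<and> f t \<in> T" if "t \<in> B" for t
      using f[OF that] by (auto simp: G)
    show "f t \<in> B" if "t \<in> B" for t
      using f[OF that] that by (auto simp: B_def split: if_splits)
  qed (fact union disj sub)+
  ultimately show ?thesis
    by (intro planted_graph.unique_optimum planted_graph.intro)
qed

text \<open>The default value \<open>False\<close> of the product measure excludes all pairs outside
  the index set.\<close>

lemma set_pmf_random_edges:
  assumes "finite S" "finite S'" "T \<subseteq> S" "T' \<subseteq> S'" "R \<in> set_pmf (random_edges p1 p2 S T S' T')"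
  shows "R \<subseteq> cross (S - T) T \<union> cross (S' - T') T'"
proof -
  define I where "I = cross (S - T) T \<union> cross (S' - T') T'"
  have "I \<subseteq> Pow (S \<union> S')"
    using assms by (auto simp: I_def cross_def)
  then have "finite I"
    using assms by (auto intro: finite_subset)
  then show ?thesis
    using assms(5) set_Pi_pmf_subset[of I False]
    unfolding random_edges_def I_def[symmetric] by fastforce
qed

theorem theorem1p8:
  shows "\<exists>(c1::real) (c2::real) (c3::int) (c4::real) (c5::real) (C::real) (k::nat).
    0 < c1 \<and> 0 < c2 \<and> c2 < 1 / 2 \<and> 0 < c3 \<and> 1 \<le> c4 \<and> 0 < c5 \<and> c5 < 1 \<and> 0 < C \<and> 0 < k \<and>
    (\<forall>(n::nat) (\<epsilon>1::real) (\<epsilon>2::real) (p1::real) (p2::real) (c::real) (r::real)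
       (l1::real) (l2::real) (S::nat set) (D::edges pmf).
       0 < n \<longrightarrow>
       p1 \<in> {c1 * ln (real n) / real n <.. 1} \<longrightarrow>
       p2 \<in> {c1 * ln (real n) / real n <.. 1} \<longrightarrow>
       \<epsilon>1 \<in> {1 / real n .. c2} \<longrightarrow>
       \<epsilon>2 \<in> {1 / real n .. c2} \<longrightarrow>
       c \<le> real_of_int c3 \<longrightarrow>
       r \<le> c4 \<longrightarrow>
       c5 \<le> l1 \<longrightarrow>
       c5 \<le> l2 \<longrightarrow>
       VBM n \<epsilon>1 \<epsilon>2 p1 p2 c r l1 l2 S D \<longrightarrow>
       1 - C / real n ^ k \<le>
         measure_pmf.prob D
           {G. {(U, \<eta>). sdp_optimal n G U \<eta>} = {(planted_U n S, planted_eta n G S)}})"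
proof (intro exI conjI allI impI)
  fix n :: nat and \<epsilon>1 \<epsilon>2 p1 p2 c r l1 l2 :: real and S :: "nat set" and D :: "edges pmf"
  \<comment> \<open>The existential witnesses are read off by unification: \<open>c1 = 1000\<close>,
    \<open>c2 = 1 / 10000\<close>, \<open>c3 = 1\<close>, \<open>c4 = 1\<close>,
    \<open>c5 = 9 / 10\<close>, and from the final bound \<open>C = 1\<close> and
    \<open>k = 1\<close>.\<close>
  assume n: "0 < n"
    and p1: "p1 \<in> {1000 * ln (real n) / real n <.. 1}"
    and p2: "p2 \<in> {1000 * ln (real n) / real n <.. 1}"
    and \<epsilon>: "\<epsilon>1 \<in> {1 / real n .. 1 / 10000}" "\<epsilon>2 \<in> {1 / real n .. 1 / 10000}"
    and c: "c \<le> real_of_int 1" and r: "r \<le> 1" and l: "9 / 10 \<le> l1" "9 / 10 \<le> l2"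
    and VBM: "VBM n \<epsilon>1 \<epsilon>2 p1 p2 c r l1 l2 S D"
  define good where
    "good = {G. {(U, \<eta>). sdp_optimal n G U \<eta>} = {(planted_U n S, planted_eta n G S)}}"
  obtain T S' T' adv where part: "planted_partition n \<epsilon>1 \<epsilon>2 S T S' T'"
    and adv: "\<And>R. R \<in> set_pmf (random_edges p1 p2 S T S' T') \<Longrightarrow> completion c r l1 l2 S T S' T' R (adv R)"
    and D: "D = map_pmf adv (random_edges p1 p2 S T S' T')"
    using VBM unfolding VBM_def by blast
  have "0 \<le> 1000 * ln (real n) / real n" using n by simp
  then have p_pos: "0 < p1" "0 < p2" using p1 p2 by auto
  have sub: "T \<subseteq> S" "T' \<subseteq> S'" using part by (auto simp: planted_partition_def)
  have \<epsilon>': "\<epsilon>1 \<le> 1 / 10000" "\<epsilon>2 \<le> 1 / 10000" using \<epsilon> by auto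
  have "1 - 1 / real n \<le> measure_pmf.prob (random_edges p1 p2 S T S' T')
      {R. typical_degrees p1 (S - T) T R \<and> typical_degrees p2 (S' - T') T' R}"
    by (rule random_edges_typical[OF part n p1 p2 \<epsilon>'])
  also have "\<dots> \<le> measure_pmf.prob (random_edges p1 p2 S T S' T') (adv -` good)"
  proof (rule measure_pmf.finite_measure_mono_AE)
    \<comment> \<open>Typicality is an event of \<open>R\<close> alone, so the adversary may react
      to \<open>R\<close>. The inclusion is shown on the support only, where \<open>adv\<close> is
      known to produce a completion.\<close>
    show "AE R in random_edges p1 p2 S T S' T'.
        R \<in> {R. typical_degrees p1 (S - T) T R \<and> typical_degrees p2 (S' - T') T' R} \<longrightarrow> R \<in> adv -` good"
    proof (rule AE_pmfI, rule impI)
      fix R assume R: "R \<in> set_pmf (random_edges p1 p2 S T S' T')"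
        "R \<in> {R. typical_degrees p1 (S - T) T R \<and> typical_degrees p2 (S' - T') T' R}"
      have "R \<subseteq> cross (S - T) T \<union> cross (S' - T') T'"
        by (rule set_pmf_random_edges[OF planted_partition_card(1,2)[OF part \<epsilon>'] sub R(1)])
      then show "R \<in> adv -` good"
        using completion_unique_optimum[OF part n \<epsilon>' p_pos adv[OF R(1)] _ _ _ _ r l] R(2) c
        by (simp add: good_def)
    qed
  qed simp
  finally show "1 - 1 / real n ^ 1 \<le> measure_pmf.prob D good"
    by (simp add: D)
qed simp_all

end
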